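(* Let $O=(\rho,\gamma)$ be an object with $\rho,\gamma$ of full rank, and let $Q=(\mathrm{diag}(s,r),\mathrm{diag}(t,v))$ be a qubit with energy gap $E>0$ in a diagonal full-rank state ($s,r,t,v>0$, $s+r=t+v=1$, $v/t=e^{-\beta E}$, where $r$ is the occupation probability of the upper level). Then $O$ can be used both for cooling and for heating $Q$ if and only if $$D(O)>D(Q).$$ If $D(O)\le D(Q)$, then $O$ can be used for cooling $Q$ only if $Q$ is hotter than its equilibrium state ($r>v$), and $O$ can be used for heating $Q$ only if $Q$ is colder than its equilibrium state ($r<v$).
   Context: Fix a reference inverse temperature $\beta\in\mathbb{R}$, $\beta\ne0$. An object is a pair $(\rho,\gamma)$ of density matrices on a finite-dimensional complex Hilbert space, where $\gamma$ (the equilibrium state) has full rank. Equilibrium objects are those of the form $(\hat\gamma,\hat\gamma)$ with $\hat\gamma$ of full rank. The composition is $(\rho,\gamma)\times(\tilde\rho,\tilde\gamma)=(\rho\otimes\tilde\rho,\gamma\otimes\tilde\gamma)$. An allowed transformation on $(\rho,\gamma)$ is $\rho\mapsto u\rho u^*$ with $u$ a unitary commuting with $\gamma$. $O$ can be used for cooling (respectively heating) $Q$ if there is a (finite-dimensional) equilibrium object $O_e$ and an allowed transformation on $O\times O_e\times Q$ that strictly decreases the occupation probability of the upper (respectively lower) level of $Q$ (computed from the reduced state on $Q$). For unit eigenvectors $|i\rangle,|j\rangle$ of $\gamma$ with eigenvalues $\lambda_i,\lambda_j$ set $f_{|i\rangle,|j\rangle}(O):=\ln\langle i|\rho|i\rangle-\ln\langle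 j|\rho|j\rangle-\ln\lambda_i+\ln\lambda_j$. The maximal diagonal deviation is $D(O):=\max|f_{|i\rangle,|j\rangle}(O)|$ over all pairs of unit eigenvectors of $\gamma$; $D(Q)$ is defined in the same way. *)

theory Defs
  imports
    "Jordan_Normal_Form.Char_Poly"
    "Jordan_Normal_Form.Schur_Decomposition"
    "Jordan_Normal_Form.DL_Rank"
begin

text \<open>States on an n-dimensional Hilbert space are complex n x n matrices. The order on
  complex numbers is the one of \<open>HOL-Library.Complex_Order\<close>: \<open>0 \<le> z\<close> means that z is real and
  nonnegative.\<close>

definition mat_trace :: "complex mat \<Rightarrow> complex" where
  "mat_trace A = (\<Sum>i<dim_row A. A $$ (i, i))"

definition density_matrix :: "nat \<Rightarrow> complex mat \<Rightarrow> bool" where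
  "density_matrix n \<rho> \<longleftrightarrow>
     \<rho> \<in> carrier_mat n n \<and> mat_adjoint \<rho> = \<rho> \<and>
     (\<forall>x\<in>carrier_vec n. 0 \<le> (\<rho> *\<^sub>v x) \<bullet>c x) \<and> mat_trace \<rho> = 1"

definition full_rank :: "nat \<Rightarrow> complex mat \<Rightarrow> bool" where
  "full_rank n A \<longleftrightarrow> A \<in> carrier_mat n n \<and> vec_space.rank n A = n"

definition unitary_mat :: "nat \<Rightarrow> complex mat \<Rightarrow> bool" where
  "unitary_mat n u \<longleftrightarrow>
     u \<in> carrier_mat n n \<and> u * mat_adjoint u = 1\<^sub>m n \<and> mat_adjoint u * u = 1\<^sub>m n"

text \<open>An object is a pair \<open>(\<rho>, \<gamma>)\<close> of an actual state and a full-rank equilibrium state.\<close>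

type_synonym thermo_object = "complex mat \<times> complex mat"

definition is_object :: "nat \<Rightarrow> thermo_object \<Rightarrow> bool" where
  "is_object n X \<longleftrightarrow>
     density_matrix n (fst X) \<and> density_matrix n (snd X) \<and> full_rank n (snd X)"

definition equilibrium_object :: "nat \<Rightarrow> thermo_object \<Rightarrow> bool" where
  "equilibrium_object n X \<longleftrightarrow> is_object n X \<and> fst X = snd X"

text \<open>The Kronecker product identifies the product basis vector \<open>|i\<rangle> \<otimes> |j\<rangle>\<close> with the basis vector
  of index \<open>i * d + j\<close>, where d is the dimension of the second factor.\<close>

definition kronecker :: "complex mat \<Rightarrow> complex mat \<Rightarrow> complex mat" where
  "kronecker A B = mat (dim_row A * dim_row B) (dim_col A * dim_col B)
     (\<lambda>(i, j). A $$ (i div dim_row B, j div dim_col B) * B $$ (i mod dim_row B, j mod dim_col B))"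

definition object_times :: "thermo_object \<Rightarrow> thermo_object \<Rightarrow> thermo_object"
    (infixl "\<otimes>\<^sub>o" 70) where
  "X \<otimes>\<^sub>o Y = (kronecker (fst X) (fst Y), kronecker (snd X) (snd Y))"

definition allowed_unitary :: "thermo_object \<Rightarrow> complex mat \<Rightarrow> bool" where
  "allowed_unitary X u \<longleftrightarrow> unitary_mat (dim_row (snd X)) u \<and> u * snd X = snd X * u"

definition transform :: "complex mat \<Rightarrow> thermo_object \<Rightarrow> thermo_object" where
  "transform u X = (u * fst X * mat_adjoint u, snd X)"

text \<open>Partial trace over the first factor of a bipartite system whose second factor has
  dimension d.\<close>

definition reduced_state :: "nat \<Rightarrow> complex mat \<Rightarrow> complex mat" where
  "reduced_state d A = mat d d
     (\<lambda>(a, b). \<Sum>i<dim_row A div d. A $$ (i * d + a, i * d + b))"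

text \<open>The last tensor factor is a qubit; its lower level has index 0, its upper level index 1.\<close>

definition lower_occupation :: "thermo_object \<Rightarrow> real" where
  "lower_occupation X = Re (reduced_state 2 (fst X) $$ (0, 0))"

definition upper_occupation :: "thermo_object \<Rightarrow> real" where
  "upper_occupation X = Re (reduced_state 2 (fst X) $$ (1, 1))"

definition usable_for_cooling :: "thermo_object \<Rightarrow> thermo_object \<Rightarrow> bool" where
  "usable_for_cooling X Q \<longleftrightarrow>
     (\<exists>m Y u. equilibrium_object m Y \<and> allowed_unitary (X \<otimes>\<^sub>o Y \<otimes>\<^sub>o Q) u \<and>
        upper_occupation (transform u (X \<otimes>\<^sub>o Y \<otimes>\<^sub>o Q)) < upper_occupation (X \<otimes>\<^sub>o Y \<otimes>\<^sub>o Q))"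

definition usable_for_heating :: "thermo_object \<Rightarrow> thermo_object \<Rightarrow> bool" where
  "usable_for_heating X Q \<longleftrightarrow>
     (\<exists>m Y u. equilibrium_object m Y \<and> allowed_unitary (X \<otimes>\<^sub>o Y \<otimes>\<^sub>o Q) u \<and>
        lower_occupation (transform u (X \<otimes>\<^sub>o Y \<otimes>\<^sub>o Q)) < lower_occupation (X \<otimes>\<^sub>o Y \<otimes>\<^sub>o Q))"

definition unit_eigenvector :: "complex mat \<Rightarrow> complex vec \<Rightarrow> real \<Rightarrow> bool" where
  "unit_eigenvector A x a \<longleftrightarrow> eigenvector A x (complex_of_real a) \<and> x \<bullet>c x = 1"

definition expectation_value :: "complex mat \<Rightarrow> complex vec \<Rightarrow> real" where
  "expectation_value A x = Re ((A *\<^sub>v x) \<bullet>c x)"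

text \<open>The deviation for eigenvectors x, y of the equilibrium state with eigenvalues a, b.\<close>

definition diagonal_deviation ::
    "thermo_object \<Rightarrow> complex vec \<Rightarrow> real \<Rightarrow> complex vec \<Rightarrow> real \<Rightarrow> real" where
  "diagonal_deviation X x a y b =
     ln (expectation_value (fst X) x) - ln (expectation_value (fst X) y) - ln a + ln b"

text \<open>The supremum is a maximum when both matrices of the object have full rank: the deviation
  is then a continuous function on the compact set of pairs of unit eigenvectors. Since the
  equilibrium state is Hermitian, restricting to real eigenvalues loses nothing.\<close>

definition max_diagonal_deviation :: "thermo_object \<Rightarrow> real" where
  "max_diagonal_deviation X =
     Sup {\<bar>diagonal_deviation X x a y b\<bar> | x a y b.
            unit_eigenvector (snd X) x a \<and> unit_eigenvector (snd X) y b}"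

definition diag_qubit :: "real \<Rightarrow> real \<Rightarrow> complex mat" where
  "diag_qubit p q = mat_diag 2 (\<lambda>k. complex_of_real (if k = 0 then p else q))"

end

theory Submission
  imports Defs
begin

text \<open>Let \<open>R x a = \<langle>x|\<rho>|x\<rangle> / a\<close> for a unit eigenvector x of \<open>\<gamma>\<close> with eigenvalue a. Depleting the level p of the
  qubit with diagonals w and \<open>\<tau>\<close>, where q is the other level, is possible iff
  \<open>(w q / \<tau> q) * R y b < (w p / \<tau> p) * R x a\<close> for some x and y. If so, an equilibrium qubit makes the
  energies of \<open>x \<otimes> e\<^sub>0 \<otimes> e\<^sub>p\<close> and \<open>y \<otimes> e\<^sub>1 \<otimes> e\<^sub>q\<close> equal, and one exchanges these two vectors, the first of
  which is the more populated one. If not, some \<open>\<kappa>\<close> separates the two sides, and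
  \<open>G = \<rho>\<^sub>t\<^sub>o\<^sub>t - \<kappa> \<gamma>\<^sub>t\<^sub>o\<^sub>t\<close> is nonnegative on the eigenvectors of \<open>\<gamma>\<^sub>t\<^sub>o\<^sub>t\<close> carried by level q and nonpositive on
  those carried by level p. In a product eigenbasis the rows of an allowed unitary, restricted to either
  level, are such eigenvectors, so the unitary cannot decrease the trace of G over level p; and the trace
  of \<open>\<gamma>\<^sub>t\<^sub>o\<^sub>t\<close> over level p is conserved. In terms of deviations the criteria for cooling and heating read
  \<open>c < f\<close> and \<open>- c < f\<close> with \<open>D Q = \<bar>c\<bar>\<close>, and the set of deviations f is symmetric about 0.\<close>

section \<open>Adjoints and the spectral theorem\<close>

lemma adjoint_carrier [simp, intro]: "A \<in> carrier_mat n m \<Longrightarrow> mat_adjoint A \<in> carrier_mat m n"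
  by (auto simp: mat_adjoint_def mat_of_rows_def)

lemma adjoint_dim [simp]: "dim_row (mat_adjoint A) = dim_col A" "dim_col (mat_adjoint A) = dim_row A"
  by (auto simp: mat_adjoint_def mat_of_rows_def)

lemma adjoint_index [simp]:
  fixes A :: "complex mat"
  assumes "i < dim_col A" "j < dim_row A"
  shows "mat_adjoint A $$ (i, j) = cnj (A $$ (j, i))"
  using assms by (simp add: mat_adjoint_def mat_of_rows_def)

lemma mult_index:
  assumes "A \<in> carrier_mat n m" "B \<in> carrier_mat m k" "i < n" "j < k"
  shows "(A * B) $$ (i, j) = (\<Sum>l<m. A $$ (i, l) * B $$ (l, j))"
  using assms by (simp add: scalar_prod_def atLeast0LessThan)

lemma mult_vec_index:
  assumes "A \<in> carrier_mat n m" "x \<in> carrier_vec m" "i < n"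
  shows "(A *\<^sub>v x) $ i = (\<Sum>l<m. A $$ (i, l) * x $ l)"
  using assms by (simp add: scalar_prod_def atLeast0LessThan)

lemma cscalar_prod_sum:
  fixes x y :: "complex vec"
  assumes "y \<in> carrier_vec n"
  shows "x \<bullet>c y = (\<Sum>l<n. x $ l * cnj (y $ l))"
  using assms by (simp add: scalar_prod_def atLeast0LessThan)

lemma cscalar_prod_smult:
  fixes x y :: "complex vec"
  assumes "x \<in> carrier_vec n" "y \<in> carrier_vec n"
  shows "(a \<cdot>\<^sub>v x) \<bullet>c (b \<cdot>\<^sub>v y) = a * cnj b * (x \<bullet>c y)"
  using assms by (simp add: cscalar_prod_sum[of _ n] sum_distrib_left ac_simps)

lemma adjoint_adjoint [simp]:
  fixes A :: "complex mat"
  shows "mat_adjoint (mat_adjoint A) = A"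
  by (rule eq_matI) auto

lemma adjoint_mult:
  fixes A B :: "complex mat"
  assumes A: "A \<in> carrier_mat n m" and B: "B \<in> carrier_mat m k"
  shows "mat_adjoint (A * B) = mat_adjoint B * mat_adjoint A"
proof (rule eq_matI)
  fix i j assume "i < dim_row (mat_adjoint B * mat_adjoint A)" "j < dim_col (mat_adjoint B * mat_adjoint A)"
  then have ij: "i < k" "j < n" using A B by auto
  have "mat_adjoint (A * B) $$ (i, j) = cnj ((A * B) $$ (j, i))"
    using A B ij by (intro adjoint_index) auto
  also have "\<dots> = (\<Sum>l<m. mat_adjoint B $$ (i, l) * mat_adjoint A $$ (l, j))"
    unfolding mult_index[OF A B ij(2,1)] using A B ij by (simp add: mult.commute)
  also have "\<dots> = (mat_adjoint B * mat_adjoint A) $$ (i, j)"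
    by (rule mult_index[symmetric]) (use A B ij in auto)
  finally show "mat_adjoint (A * B) $$ (i, j) = (mat_adjoint B * mat_adjoint A) $$ (i, j)" .
qed (use A B in auto)

lemma adjoint_one [simp]: "mat_adjoint (1\<^sub>m n :: complex mat) = 1\<^sub>m n"
  by (rule eq_matI) auto

lemma cscalar_prod_adjoint:
  fixes A :: "complex mat"
  assumes A: "A \<in> carrier_mat n m" and x: "x \<in> carrier_vec m" and y: "y \<in> carrier_vec n"
  shows "(A *\<^sub>v x) \<bullet>c y = x \<bullet>c (mat_adjoint A *\<^sub>v y)"
proof -
  have "(A *\<^sub>v x) \<bullet>c y = (\<Sum>i<n. \<Sum>l<m. A $$ (i, l) * x $ l * cnj (y $ i))"
    using A x by (simp add: cscalar_prod_sum[OF y] mult_vec_index sum_distrib_right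
        del: index_mult_mat_vec)
  also have "\<dots> = (\<Sum>l<m. \<Sum>i<n. A $$ (i, l) * x $ l * cnj (y $ i))"
    by (rule sum.swap)
  also have "\<dots> = (\<Sum>l<m. x $ l * cnj ((mat_adjoint A *\<^sub>v y) $ l))"
    by (rule sum.cong[OF refl], subst mult_vec_index[OF adjoint_carrier[OF A] y])
      (use A in \<open>auto simp: sum_distrib_left intro!: sum.cong\<close>)
  also have "\<dots> = x \<bullet>c (mat_adjoint A *\<^sub>v y)"
    by (rule cscalar_prod_sum[symmetric]) (rule mult_mat_vec_carrier[OF adjoint_carrier[OF A] y])
  finally show ?thesis .
qed

lemma unitary_matD:
  assumes "unitary_mat n u"
  shows "u \<in> carrier_mat n n" "u * mat_adjoint u = 1\<^sub>m n" "mat_adjoint u * u = 1\<^sub>m n"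
  using assms by (auto simp: unitary_mat_def)

lemma unitary_matI:
  fixes u :: "complex mat"
  assumes "u \<in> carrier_mat n n" "mat_adjoint u * u = 1\<^sub>m n"
  shows "unitary_mat n u"
  using assms mat_mult_left_right_inverse[of "mat_adjoint u" n u] by (auto simp: unitary_mat_def)

lemma unitary_mat_mult:
  assumes u: "unitary_mat n u" and v: "unitary_mat n v"
  shows "unitary_mat n (u * v)"
proof (rule unitary_matI)
  note [simp] = unitary_matD[OF u] unitary_matD[OF v]
  show "u * v \<in> carrier_mat n n" by (rule mult_carrier_mat[of _ n n]) simp_all
  have "mat_adjoint (u * v) * (u * v) = mat_adjoint v * (mat_adjoint u * (u * v))"
    unfolding adjoint_mult[OF unitary_matD(1)[OF u] unitary_matD(1)[OF v]]
    by (rule assoc_mult_mat[of _ n n _ n _ n]) (auto intro!: mult_carrier_mat[of _ n n])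
  also have "mat_adjoint u * (u * v) = (mat_adjoint u * u) * v"
    by (rule assoc_mult_mat[symmetric, of _ n n _ n _ n]) auto
  finally show "mat_adjoint (u * v) * (u * v) = 1\<^sub>m n" by (simp add: left_mult_one_mat[of _ n n])
qed

lemma unitary_mat_adjoint: "unitary_mat n u \<Longrightarrow> unitary_mat n (mat_adjoint u)"
  by (auto simp: unitary_mat_def)

lemma trace_comm:
  assumes A: "A \<in> carrier_mat n m" and B: "B \<in> carrier_mat m n"
  shows "mat_trace (A * B) = mat_trace (B * A)"
proof -
  have "mat_trace (A * B) = (\<Sum>i<n. \<Sum>l<m. A $$ (i, l) * B $$ (l, i))"
    unfolding mat_trace_def using A by (auto intro!: sum.cong mult_index[OF A B])
  also have "\<dots> = (\<Sum>l<m. \<Sum>i<n. B $$ (l, i) * A $$ (i, l))"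
    by (subst sum.swap) (simp add: mult.commute)
  also have "\<dots> = mat_trace (B * A)"
    unfolding mat_trace_def using B by (auto intro!: sum.cong mult_index[OF B A, symmetric])
  finally show ?thesis .
qed

section \<open>Unitary completion and diagonalisation of Hermitian matrices\<close>

lemma normalize_corthogonal:
  fixes W :: "complex mat"
  assumes W: "W \<in> carrier_mat n n" and orth: "corthogonal_mat W"
  obtains c :: "nat \<Rightarrow> complex" where "unitary_mat n (mat n n (\<lambda>(i, j). c j * W $$ (i, j)))"
proof -
  \<comment> \<open>The reciprocal norm of column j. The columns of a \<open>corthogonal_mat\<close>
    are pairwise orthogonal and nonzero but of arbitrary length, so only this rescaling is missing
    for unitarity.\<close>
  define c where "c j = complex_of_real (1 / sqrt (Re (col W j \<bullet>c col W j)))" for j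
  define V where "V = mat n n (\<lambda>(i, j). c j * W $$ (i, j))"
  have V: "V \<in> carrier_mat n n" by (simp add: V_def)
  have c: "cnj (c j) = c j" for j by (simp add: c_def)
  have "mat_adjoint V * V = 1\<^sub>m n"
  proof (rule eq_matI)
    fix i j assume "i < dim_row (1\<^sub>m n :: complex mat)" "j < dim_col (1\<^sub>m n :: complex mat)"
    then have ij: "i < n" "j < n" by auto
    have "(mat_adjoint V * V) $$ (i, j) = (\<Sum>l<n. cnj (V $$ (l, i)) * V $$ (l, j))"
      by (subst mult_index[OF adjoint_carrier[OF V] V ij]) (use V ij in auto)
    also have "\<dots> = c i * c j * (\<Sum>l<n. W $$ (l, j) * cnj (W $$ (l, i)))"
      using ij by (simp add: V_def c sum_distrib_left ac_simps)
    also have "(\<Sum>l<n. W $$ (l, j) * cnj (W $$ (l, i))) = col W j \<bullet>c col W i"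
      by (subst cscalar_prod_sum[of _ n]) (use W ij in auto)
    also have "c i * c j * (col W j \<bullet>c col W i) = (if i = j then 1 else 0)"
    proof (cases "i = j")
      case False
      then show ?thesis using corthogonal_matD[OF orth, of j i] W ij by auto
    next
      case True
      let ?q = "col W i \<bullet>c col W i"
      have "0 \<le> ?q" by (rule conjugate_square_ge_0_vec)
      moreover have "?q \<noteq> 0" using corthogonal_matD[OF orth, of i i] W ij by auto
      ultimately have q: "?q = complex_of_real (Re ?q)" "Re ?q > 0"
        by (auto simp: less_eq_complex_def complex_eq_iff)
      have "c i * c i * ?q = complex_of_real (1 / sqrt (Re ?q) * (1 / sqrt (Re ?q)) * Re ?q)"
        unfolding of_real_mult q(1)[symmetric] by (simp add: c_def)
      also have "1 / sqrt (Re ?q) * (1 / sqrt (Re ?q)) * Re ?q = 1"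
        using q(2) by (simp add: field_simps)
      finally show ?thesis using True by simp
    qed
    finally show "(mat_adjoint V * V) $$ (i, j) = 1\<^sub>m n $$ (i, j)" using ij by simp
  qed (use V in auto)
  with V have "unitary_mat n V" by (rule unitary_matI)
  then show ?thesis unfolding V_def by (rule that)
qed

text \<open>Gram-Schmidt keeps the head of its list, so starting from a basis that begins with v
  leaves v in front; normalising then changes it only by a scalar. For an eigenvector v the first
  column is therefore still an eigenvector, which the deflation below relies on.\<close>

lemma unitary_first_column:
  fixes v :: "complex vec"
  assumes v: "v \<in> carrier_vec n" and v0: "v \<noteq> 0\<^sub>v n"
  obtains W c where "unitary_mat n W" "col W 0 = c \<cdot>\<^sub>v v"
proof -
  have n: "0 < n" using v v0 by (cases n) auto
  interpret cof_vec_space n "TYPE(complex)" .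
  define b where "b = basis_completion v"
  define ws where "ws = gram_schmidt n b"
  from basis_completion[OF v v0, folded b_def]
  have b: "distinct b" "\<not> lin_dep (set b)" "set b \<subseteq> carrier_vec n" "hd b = v" "length b = n"
    by auto
  then obtain vs where bv: "b = v # vs" using n by (cases b) auto
  from gram_schmidt_result[OF b(3,1,2) ws_def] b(5)
  have ws: "set ws \<subseteq> carrier_vec n" "corthogonal ws" "length ws = n" by auto
  have hdws: "ws ! 0 = v"
    using gram_schmidt_hd[OF v, of vs] ws(3) n by (cases ws) (auto simp: ws_def bv)
  define W where "W = mat_of_cols n ws"
  have W: "W \<in> carrier_mat n n" using ws mat_of_cols_carrier(1)[of n ws] by (simp add: W_def)
  obtain c where u: "unitary_mat n (mat n n (\<lambda>(i, j). c j * W $$ (i, j)))"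
    using normalize_corthogonal[OF W] orthogonal_mat_of_cols[OF ws] by (auto simp: W_def)
  have "col W 0 = v" using ws v n hdws by (simp add: W_def)
  moreover have "col (mat n n (\<lambda>(i, j). c j * W $$ (i, j))) 0 = c 0 \<cdot>\<^sub>v col W 0"
    using n W by (intro eq_vecI) auto
  ultimately show ?thesis using that[OF u] by simp
qed

lemma exists_eigenvector:
  fixes A :: "complex mat"
  assumes A: "A \<in> carrier_mat n n" and n: "0 < n"
  obtains v e where "eigenvector A v e"
proof -
  from char_poly_factorized[OF A] obtain as
    where as: "char_poly A = (\<Prod>a\<leftarrow>as. [:- a, 1:])" "length as = n" by blast
  then obtain e es where "as = e # es" using n by (cases as) auto
  then have "poly (char_poly A) e = 0" by (simp add: as(1))
  then have "eigenvalue A e" using eigenvalue_root_char_poly[OF A] by simp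
  then show ?thesis using that by (auto simp: eigenvalue_def)
qed

lemma mult_four_block_diag:
  fixes A :: "'a :: comm_ring_1 mat"
  assumes "A \<in> carrier_mat 1 1" "B \<in> carrier_mat n n" "C \<in> carrier_mat 1 1" "D \<in> carrier_mat n n"
  shows "four_block_mat A (0\<^sub>m 1 n) (0\<^sub>m n 1) B * four_block_mat C (0\<^sub>m 1 n) (0\<^sub>m n 1) D
    = four_block_mat (A * C) (0\<^sub>m 1 n) (0\<^sub>m n 1) (B * D)"
  using assms by (subst mult_four_block_mat[of _ 1 1 _ n _ n _ _ 1 _ n]) auto

lemma adjoint_four_block_diag:
  fixes B :: "complex mat"
  assumes "B \<in> carrier_mat n n" "A \<in> carrier_mat 1 1"
  shows "mat_adjoint (four_block_mat A (0\<^sub>m 1 n) (0\<^sub>m n 1) B)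
    = four_block_mat (mat_adjoint A) (0\<^sub>m 1 n) (0\<^sub>m n 1) (mat_adjoint B)"
  by (rule eq_matI) (use assms in auto)

lemma conj_mult:
  fixes W V :: "complex mat"
  assumes "W \<in> carrier_mat n n" "V \<in> carrier_mat n n" "B \<in> carrier_mat n n"
  shows "(W * V) * B * mat_adjoint (W * V) = W * (V * B * mat_adjoint V) * mat_adjoint W"
proof -
  note [simp] = assms mult_carrier_mat[of _ n n _ n] assoc_mult_mat[of _ n n _ n _ n]
  show ?thesis by (simp add: adjoint_mult[OF assms(1,2)])
qed

text \<open>Deflation by induction on the dimension: a unitary W whose first column is an
  eigenvector turns A into a block matrix with the eigenvalue in the corner and a smaller Hermitian
  block C, whose diagonalisation is then extended by a fixed first basis vector.\<close>

lemma hermitian_spectral: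
  fixes A :: "complex mat"
  assumes "A \<in> carrier_mat n n" "mat_adjoint A = A"
  shows "\<exists>V d. unitary_mat n V \<and> A = V * mat_diag n (\<lambda>i. complex_of_real (d i)) * mat_adjoint V"
  using assms
proof (induction n arbitrary: A)
  case 0
  then show ?case
    by (intro exI[of _ "1\<^sub>m 0"]) (auto simp: unitary_mat_def intro!: eq_matI)
next
  case (Suc n)
  note A = Suc.prems(1)
  obtain v e where ev: "eigenvector A v e" using exists_eigenvector[OF A] by auto
  then have v: "v \<in> carrier_vec (Suc n)" "v \<noteq> 0\<^sub>v (Suc n)" "A *\<^sub>v v = e \<cdot>\<^sub>v v"
    using A by (auto simp: eigenvector_def)
  obtain W c where u: "unitary_mat (Suc n) W" and c: "col W 0 = c \<cdot>\<^sub>v v"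
    using unitary_first_column[OF v(1,2)] .
  note W = unitary_matD[OF u]
  note [simp] = W A adjoint_carrier[OF W(1)] mult_carrier_mat[of _ "Suc n" "Suc n" _ "Suc n"]
  note as = assoc_mult_mat[of _ "Suc n" "Suc n" _ "Suc n" _ "Suc n"]
  define B where "B = mat_adjoint W * A * W"
  have B[simp]: "B \<in> carrier_mat (Suc n) (Suc n)" by (simp add: B_def)
  note [simp] = carrier_matD[OF B]
  have herm: "mat_adjoint B = B"
    by (simp add: B_def adjoint_mult[of _ "Suc n" "Suc n" _ "Suc n"] Suc.prems(2) as)
  have "W * B * mat_adjoint W = (W * mat_adjoint W) * (A * (W * mat_adjoint W))"
    by (simp add: B_def as del: W(2,3))
  then have A_eq: "A = W * B * mat_adjoint W"
    by (simp add: left_mult_one_mat[of _ "Suc n" "Suc n"] right_mult_one_mat[of _ "Suc n" "Suc n"])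
  have colW [simp]: "col W 0 \<in> carrier_vec (Suc n)" unfolding c using v by simp
  have colB: "col B 0 = e \<cdot>\<^sub>v unit_vec (Suc n) 0"
  proof -
    have "col B 0 = mat_adjoint W *\<^sub>v (A *\<^sub>v col W 0)"
      by (simp add: B_def as col_mult2[of _ "Suc n" "Suc n" _ "Suc n"])
    also have "A *\<^sub>v col W 0 = e \<cdot>\<^sub>v col W 0"
      using v A by (simp add: c mult_mat_vec[of _ "Suc n" "Suc n"] smult_smult_assoc mult.commute)
    also have "mat_adjoint W *\<^sub>v (e \<cdot>\<^sub>v col W 0) = e \<cdot>\<^sub>v (mat_adjoint W *\<^sub>v col W 0)"
      by (rule mult_mat_vec[of _ "Suc n" "Suc n"]) auto
    also have "mat_adjoint W *\<^sub>v col W 0 = col (mat_adjoint W * W) 0"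
      by (rule col_mult2[symmetric, of _ "Suc n" "Suc n" _ "Suc n"]) auto
    finally show ?thesis by simp
  qed
  have B0: "B $$ (i, 0) = (if i = 0 then e else 0)" if "i < Suc n" for i
    using arg_cong[OF colB, of "\<lambda>x. x $ i"] that B by auto
  \<comment> \<open>Hermiticity transports the zeros of the first column to the first row, and
    comparing both formulas at index 0 shows that the corner entry e is real.\<close>
  have B0': "B $$ (0, i) = (if i = 0 then cnj e else 0)" if "i < Suc n" for i
  proof -
    have "B $$ (0, i) = cnj (B $$ (i, 0))"
      using that B by (subst herm[symmetric]) (subst adjoint_index, auto)
    then show ?thesis using B0[OF that] by auto
  qed
  have e: "e = complex_of_real (Re e)" using B0[of 0] B0'[of 0] by (auto simp: complex_eq_iff)
  have e': "cnj e = e" by (subst (1 2) e) simp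
  define C where "C = mat n n (\<lambda>(i, j). B $$ (Suc i, Suc j))"
  have C: "C \<in> carrier_mat n n" by (simp add: C_def)
  have "mat_adjoint C = C"
  proof (rule eq_matI)
    fix i j assume "i < dim_row C" "j < dim_col C"
    then have ij: "i < n" "j < n" by (auto simp: C_def)
    have "B $$ (Suc i, Suc j) = cnj (B $$ (Suc j, Suc i))"
      using ij B by (subst herm[symmetric]) (subst adjoint_index, auto)
    then show "mat_adjoint C $$ (i, j) = C $$ (i, j)" using ij by (simp add: C_def)
  qed (auto simp: C_def)
  from Suc.IH[OF C this] obtain V d where V: "unitary_mat n V"
    and CV: "C = V * mat_diag n (\<lambda>i. complex_of_real (d i)) * mat_adjoint V" by blast
  define E where "E = mat 1 1 (\<lambda>_. e)"
  have E[simp]: "E \<in> carrier_mat 1 1" by (simp add: E_def)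
  \<comment> \<open>Borders an n-dimensional matrix by a 1, so that a unitary on the complement
    extends to one that fixes the first basis vector.\<close>
  define F where "F M = four_block_mat (1\<^sub>m 1) (0\<^sub>m 1 n) (0\<^sub>m n 1) M" for M :: "complex mat"
  have F[simp]: "F M \<in> carrier_mat (Suc n) (Suc n)" if "M \<in> carrier_mat n n" for M
    using four_block_carrier_mat[of "1\<^sub>m 1" 1 1 M n n] that by (simp add: F_def)
  have BE: "B = four_block_mat E (0\<^sub>m 1 n) (0\<^sub>m n 1) C"
    by (rule eq_matI) (use B0 B0' e' in \<open>auto simp: E_def C_def\<close>)
  \<comment> \<open>Index 0 carries the eigenvalue that was split off; the eigenvalues of C move up
    by one.\<close>
  define D where "D = mat_diag (Suc n) (\<lambda>i. complex_of_real (case i of 0 \<Rightarrow> Re e | Suc k \<Rightarrow> d k))"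
  have D: "D = four_block_mat E (0\<^sub>m 1 n) (0\<^sub>m n 1) (mat_diag n (\<lambda>i. complex_of_real (d i)))"
    by (rule eq_matI) (use e in \<open>auto simp: D_def mat_diag_def E_def split: nat.split\<close>)
  note VC[simp] = unitary_matD[OF V]
  have "F V * D * mat_adjoint (F V) = four_block_mat E (0\<^sub>m 1 n) (0\<^sub>m n 1) C"
    unfolding D F_def
    by (simp add: adjoint_four_block_diag mult_four_block_diag CV mult_carrier_mat[of _ n n]
        left_mult_one_mat[of _ 1 1] right_mult_one_mat[of _ 1 1] del: One_nat_def)
  also have "\<dots> = B" by (rule BE[symmetric])
  finally have FB: "F V * D * mat_adjoint (F V) = B" .
  have "mat_adjoint (F V) * F V = 1\<^sub>m (Suc n)"
    unfolding F_def
    by (simp add: adjoint_four_block_diag mult_four_block_diag del: One_nat_def) simp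
  then have uF: "unitary_mat (Suc n) (F V)" by (intro unitary_matI) auto
  have "A = (W * F V) * D * mat_adjoint (W * F V)"
    by (subst conj_mult[of _ "Suc n"], (simp_all add: D_def)[3]) (simp add: FB A_eq[symmetric])
  then show ?case using unitary_mat_mult[OF u uF] unfolding D_def by blast
qed

section \<open>Kronecker products\<close>

text \<open>The range is cut into p consecutive blocks of length q. With it, sums over a product
  basis split into sums over the factors, in the index convention of
  \<open>kronecker\<close>.\<close>

lemma sum_pair_index:
  fixes f :: "nat \<Rightarrow> 'a :: comm_monoid_add"
  shows "(\<Sum>a<p * q. f a) = (\<Sum>i<p. \<Sum>j<q. f (i * q + j))"
proof -
  have "sum f {i * q..<i * q + q} = (\<Sum>j<q. f (i * q + j))" for i
    using sum.shift_bounds_nat_ivl[of f 0 "i * q" q] by (simp add: atLeast0LessThan add.commute)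
  then show ?thesis by (simp add: sum.nat_group[symmetric])
qed

lemma pair_index_less:
  fixes i j :: nat
  assumes "i < p" "j < q"
  shows "i * q + j < p * q"
proof -
  have "i * q + j < Suc i * q" using assms by simp
  also have "\<dots> \<le> p * q" using assms by (intro mult_right_mono) auto
  finally show ?thesis .
qed

lemma pair_index_eq_iff:
  fixes i j k l m :: nat
  assumes "k < m" "l < m"
  shows "i * m + k = j * m + l \<longleftrightarrow> i = j \<and> k = l"
proof -
  have "(i * m + k) div m = i" "(i * m + k) mod m = k" "(j * m + l) div m = j" "(j * m + l) mod m = l"
    using assms by auto
  then show ?thesis by metis
qed

lemma pair_indexE:
  fixes a :: nat
  assumes "a < p * q"
  obtains i j where "i < p" "j < q" "a = i * q + j"
proof
  have "0 < q" using assms by (cases q) auto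
  then show "a mod q < q" by simp
  show "a div q < p" using assms by (simp add: less_mult_imp_div_less)
qed simp

lemma kronecker_carrier [simp]:
  "A \<in> carrier_mat n m \<Longrightarrow> B \<in> carrier_mat p q \<Longrightarrow> kronecker A B \<in> carrier_mat (n * p) (m * q)"
  by (auto simp: kronecker_def)

lemma kronecker_index:
  assumes "A \<in> carrier_mat n m" "B \<in> carrier_mat p q" "i < n" "k < p" "j < m" "l < q"
  shows "kronecker A B $$ (i * p + k, j * q + l) = A $$ (i, j) * B $$ (k, l)"
  using assms by (auto simp: kronecker_def pair_index_less)

lemma kronecker_eqI:
  assumes "M \<in> carrier_mat (n * p) (m * q)" "A \<in> carrier_mat n m" "B \<in> carrier_mat p q"
    and "\<And>i k j l. i < n \<Longrightarrow> k < p \<Longrightarrow> j < m \<Longrightarrow> l < q \<Longrightarrow>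
      M $$ (i * p + k, j * q + l) = A $$ (i, j) * B $$ (k, l)"
  shows "M = kronecker A B"
proof (rule eq_matI)
  fix a b assume "a < dim_row (kronecker A B)" "b < dim_col (kronecker A B)"
  then have "a < n * p" "b < m * q" using assms(2,3) by (auto simp: kronecker_def)
  obtain i k where ik: "i < n" "k < p" "a = i * p + k" using \<open>a < n * p\<close> by (rule pair_indexE)
  obtain j l where jl: "j < m" "l < q" "b = j * q + l" using \<open>b < m * q\<close> by (rule pair_indexE)
  from ik jl show "M $$ (a, b) = kronecker A B $$ (a, b)"
    using assms(4) by (simp add: kronecker_index[OF assms(2,3)])
qed (use assms(1-3) in \<open>simp_all add: kronecker_def\<close>)

lemma kronecker_mult:
  assumes A: "A \<in> carrier_mat n m" and B: "B \<in> carrier_mat p q"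
    and C: "C \<in> carrier_mat m k" and D: "D \<in> carrier_mat q l"
  shows "kronecker A B * kronecker C D = kronecker (A * C) (B * D)"
proof (rule kronecker_eqI[of _ n p k l])
  show "kronecker A B * kronecker C D \<in> carrier_mat (n * p) (k * l)"
    by (rule mult_carrier_mat[of _ _ "m * q"]) (use assms in simp_all)
  show "A * C \<in> carrier_mat n k" "B * D \<in> carrier_mat p l"
    by (rule mult_carrier_mat[OF A C] mult_carrier_mat[OF B D])+
  fix a b c d assume ix: "a < n" "b < p" "c < k" "d < l"
  have "(kronecker A B * kronecker C D) $$ (a * p + b, c * l + d)
      = (\<Sum>i<m. \<Sum>j<q. kronecker A B $$ (a * p + b, i * q + j) * kronecker C D $$ (i * q + j, c * l + d))"
    by (subst mult_index[OF kronecker_carrier[OF A B] kronecker_carrier[OF C D]])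
      (simp_all add: ix pair_index_less sum_pair_index)
  also have "\<dots> = (\<Sum>i<m. \<Sum>j<q. (A $$ (a, i) * C $$ (i, c)) * (B $$ (b, j) * D $$ (j, d)))"
    using ix by (intro sum.cong refl) (simp add: kronecker_index[OF A B] kronecker_index[OF C D])
  also have "\<dots> = (A * C) $$ (a, c) * (B * D) $$ (b, d)"
    unfolding mult_index[OF A C ix(1,3)] mult_index[OF B D ix(2,4)] by (simp add: sum_product)
  finally show "(kronecker A B * kronecker C D) $$ (a * p + b, c * l + d)
      = (A * C) $$ (a, c) * (B * D) $$ (b, d)" .
qed

lemma kronecker_adjoint:
  assumes A: "A \<in> carrier_mat n m" and B: "B \<in> carrier_mat p q"
  shows "mat_adjoint (kronecker A B) = kronecker (mat_adjoint A) (mat_adjoint B)"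
proof (rule kronecker_eqI[of _ m q n p])
  fix i k j l assume "i < m" "k < q" "j < n" "l < p"
  then show "mat_adjoint (kronecker A B) $$ (i * q + k, j * p + l)
      = mat_adjoint A $$ (i, j) * mat_adjoint B $$ (k, l)"
    using A B carrier_matD[OF kronecker_carrier[OF A B]]
    by (simp add: pair_index_less kronecker_index[OF A B])
qed (use A B in simp_all)

lemma kronecker_one: "kronecker (1\<^sub>m n) (1\<^sub>m m) = 1\<^sub>m (n * m)"
proof (rule kronecker_eqI[symmetric])
  fix i k j l assume *: "i < n" "k < m" "j < n" "l < m"
  have "i * m + k = j * m + l \<longleftrightarrow> i = j \<and> k = l"
    by (rule pair_index_eq_iff[OF *(2,4)])
  then show "(1\<^sub>m (n * m) :: complex mat) $$ (i * m + k, j * m + l) = 1\<^sub>m n $$ (i, j) * 1\<^sub>m m $$ (k, l)"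
    using * by (simp add: pair_index_less)
qed auto

lemma unitary_kronecker:
  assumes "unitary_mat n u" "unitary_mat m v"
  shows "unitary_mat (n * m) (kronecker u v)"
proof (rule unitary_matI)
  note u = unitary_matD[OF assms(1)] and v = unitary_matD[OF assms(2)]
  show "kronecker u v \<in> carrier_mat (n * m) (n * m)" using u v by simp
  show "mat_adjoint (kronecker u v) * kronecker u v = 1\<^sub>m (n * m)"
    unfolding kronecker_adjoint[OF u(1) v(1)] using u v
    by (subst kronecker_mult[of _ n n _ m m _ n _ m]) (simp_all add: kronecker_one)
qed

section \<open>Product vectors\<close>

definition kron_vec :: "complex vec \<Rightarrow> complex vec \<Rightarrow> complex vec" where
  "kron_vec x y = vec (dim_vec x * dim_vec y) (\<lambda>i. x $ (i div dim_vec y) * y $ (i mod dim_vec y))"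

lemma kron_vec_carrier [simp]:
  "x \<in> carrier_vec n \<Longrightarrow> y \<in> carrier_vec m \<Longrightarrow> kron_vec x y \<in> carrier_vec (n * m)"
  by (rule carrier_vecI) (simp add: kron_vec_def)

lemma kron_vec_index:
  assumes "x \<in> carrier_vec n" "y \<in> carrier_vec m" "i < n" "j < m"
  shows "kron_vec x y $ (i * m + j) = x $ i * y $ j"
  using assms by (auto simp: kron_vec_def pair_index_less)

lemma kronecker_mult_vec:
  assumes A: "A \<in> carrier_mat n m" and B: "B \<in> carrier_mat p q"
    and x: "x \<in> carrier_vec m" and y: "y \<in> carrier_vec q"
  shows "kronecker A B *\<^sub>v kron_vec x y = kron_vec (A *\<^sub>v x) (B *\<^sub>v y)"
proof (rule eq_vecI)
  fix a assume "a < dim_vec (kron_vec (A *\<^sub>v x) (B *\<^sub>v y))"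
  then have "a < n * p" using A B by (simp add: kron_vec_def)
  then obtain i k where ik: "i < n" "k < p" "a = i * p + k" by (rule pair_indexE)
  have "(kronecker A B *\<^sub>v kron_vec x y) $ a
      = (\<Sum>j<m. \<Sum>l<q. kronecker A B $$ (a, j * q + l) * kron_vec x y $ (j * q + l))"
    by (subst mult_vec_index[OF kronecker_carrier[OF A B] kron_vec_carrier[OF x y]])
      (simp_all add: ik pair_index_less sum_pair_index)
  also have "\<dots> = (\<Sum>j<m. \<Sum>l<q. (A $$ (i, j) * x $ j) * (B $$ (k, l) * y $ l))"
    using ik by (intro sum.cong refl) (simp add: kronecker_index[OF A B] kron_vec_index[OF x y])
  also have "\<dots> = (A *\<^sub>v x) $ i * (B *\<^sub>v y) $ k"
    unfolding mult_vec_index[OF A x ik(1)] mult_vec_index[OF B y ik(2)] by (simp add: sum_product)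
  also have "\<dots> = kron_vec (A *\<^sub>v x) (B *\<^sub>v y) $ a"
    unfolding ik(3) by (rule kron_vec_index[OF mult_mat_vec_carrier[OF A x] mult_mat_vec_carrier[OF B y] ik(1,2), symmetric])
  finally show "(kronecker A B *\<^sub>v kron_vec x y) $ a = kron_vec (A *\<^sub>v x) (B *\<^sub>v y) $ a" .
qed (use A B in \<open>simp add: kron_vec_def kronecker_def\<close>)

lemma kron_vec_cscalar_prod:
  assumes x: "x \<in> carrier_vec n" "x' \<in> carrier_vec n" and y: "y \<in> carrier_vec m" "y' \<in> carrier_vec m"
  shows "kron_vec x y \<bullet>c kron_vec x' y' = (x \<bullet>c x') * (y \<bullet>c y')"
  unfolding cscalar_prod_sum[OF kron_vec_carrier[OF x(2) y(2)]] cscalar_prod_sum[OF x(2)]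
    cscalar_prod_sum[OF y(2)] sum_pair_index sum_product
  by (intro sum.cong refl) (simp add: kron_vec_index[OF x(1) y(1)] kron_vec_index[OF x(2) y(2)])

lemma kron_vec_smult:
  assumes "x \<in> carrier_vec n" "y \<in> carrier_vec m"
  shows "kron_vec (a \<cdot>\<^sub>v x) (b \<cdot>\<^sub>v y) = (a * b) \<cdot>\<^sub>v kron_vec x y"
proof (rule eq_vecI)
  fix c assume "c < dim_vec ((a * b) \<cdot>\<^sub>v kron_vec x y)"
  then have "c < n * m" using assms by (simp add: kron_vec_def)
  then obtain i k where ik: "i < n" "k < m" "c = i * m + k" by (rule pair_indexE)
  moreover from ik have "c < dim_vec (kron_vec x y)"
    unfolding carrier_vecD[OF kron_vec_carrier[OF assms]] by (simp add: pair_index_less)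
  ultimately show "kron_vec (a \<cdot>\<^sub>v x) (b \<cdot>\<^sub>v y) $ c = ((a * b) \<cdot>\<^sub>v kron_vec x y) $ c"
    using assms by (simp add: kron_vec_index[of _ n _ m])
qed (simp add: kron_vec_def)

section \<open>Energy-conserving unitaries\<close>

lemma mult_adjoint_diag_index:
  fixes A :: "complex mat"
  assumes u: "u \<in> carrier_mat n n" and A: "A \<in> carrier_mat n n" and i: "i < n"
  shows "(u * A * mat_adjoint u) $$ (i, i) = (\<Sum>a<n. \<Sum>b<n. u $$ (i, a) * A $$ (a, b) * cnj (u $$ (i, b)))"
proof -
  have "(u * A * mat_adjoint u) $$ (i, i) = (\<Sum>b<n. (u * A) $$ (i, b) * cnj (u $$ (i, b)))"
    unfolding mult_index[OF mult_carrier_mat[OF u A] adjoint_carrier[OF u] i i]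
    using u i by (intro sum.cong) auto
  also have "\<dots> = (\<Sum>b<n. \<Sum>a<n. u $$ (i, a) * A $$ (a, b) * cnj (u $$ (i, b)))"
    using i by (intro sum.cong refl) (simp add: mult_index[OF u A] sum_distrib_right)
  also have "\<dots> = (\<Sum>a<n. \<Sum>b<n. u $$ (i, a) * A $$ (a, b) * cnj (u $$ (i, b)))"
    by (rule sum.swap)
  finally show ?thesis .
qed

text \<open>G is block diagonal, so the form of each row splits into an L part and an H part. Summed
  over all rows, the H parts give the trace of G over H, because the columns in H are orthonormal.
  Rows in L contribute at most 0 to this sum, so the rows in H alone already give at least the
  trace, and their L parts only add to it.\<close>

lemma block_diagonal_transfer:
  fixes u G :: "nat \<Rightarrow> nat \<Rightarrow> complex"
  assumes fin: "finite L" "finite H" and disj: "L \<inter> H = {}"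
    and unit: "\<And>a b. a \<in> H \<Longrightarrow> b \<in> H \<Longrightarrow> (\<Sum>i\<in>L \<union> H. u i a * cnj (u i b)) = (if a = b then 1 else 0)"
    and cross: "\<And>a b. a \<in> L \<Longrightarrow> b \<in> H \<Longrightarrow> G a b = 0 \<and> G b a = 0"
    and low: "\<And>i. i \<in> H \<Longrightarrow> 0 \<le> Re (\<Sum>a\<in>L. \<Sum>b\<in>L. u i a * G a b * cnj (u i b))"
    and high: "\<And>i. i \<in> L \<Longrightarrow> Re (\<Sum>a\<in>H. \<Sum>b\<in>H. u i a * G a b * cnj (u i b)) \<le> 0"
  shows "Re (\<Sum>a\<in>H. G a a) \<le> Re (\<Sum>i\<in>H. \<Sum>a\<in>L \<union> H. \<Sum>b\<in>L \<union> H. u i a * G a b * cnj (u i b))"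
proof -
  define q where "q S i = (\<Sum>a\<in>S. \<Sum>b\<in>S. u i a * G a b * cnj (u i b))" for S i
  have split: "q (L \<union> H) i = q L i + q H i" for i
    unfolding q_def by (simp add: sum.union_disjoint[OF fin disj] cross)
  have "(\<Sum>i\<in>L \<union> H. q H i) = (\<Sum>a\<in>H. \<Sum>b\<in>H. \<Sum>i\<in>L \<union> H. u i a * G a b * cnj (u i b))"
    unfolding q_def by (subst sum.swap, rule sum.cong[OF refl], rule sum.swap)
  also have "\<dots> = (\<Sum>a\<in>H. \<Sum>b\<in>H. G a b * (\<Sum>i\<in>L \<union> H. u i a * cnj (u i b)))"
    by (simp add: sum_distrib_left ac_simps)
  also have "\<dots> = (\<Sum>a\<in>H. \<Sum>b\<in>H. if a = b then G a b else 0)"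
    by (intro sum.cong refl) (simp add: unit)
  also have "\<dots> = (\<Sum>a\<in>H. G a a)" using fin by (simp add: sum.delta')
  finally have total: "(\<Sum>i\<in>L. Re (q H i)) + (\<Sum>i\<in>H. Re (q H i)) = Re (\<Sum>a\<in>H. G a a)"
    by (simp add: sum.union_disjoint[OF fin disj] flip: Re_sum plus_complex.sel(1))
  have "(\<Sum>i\<in>L. Re (q H i)) \<le> 0" using high by (intro sum_nonpos) (simp add: q_def)
  moreover have "0 \<le> (\<Sum>i\<in>H. Re (q L i))" using low by (intro sum_nonneg) (simp add: q_def)
  moreover have "Re (\<Sum>i\<in>H. q (L \<union> H) i) = (\<Sum>i\<in>H. Re (q L i)) + (\<Sum>i\<in>H. Re (q H i))"
    by (simp add: split sum.distrib)
  ultimately show ?thesis using total unfolding q_def by linarith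
qed

text \<open>The double sum is the quadratic form of \<alpha> \<rho> + \<kappa> \<gamma> at the
  vector V y, where y is the conjugate of c. The support condition places this vector in the
  eigenspace of \<mu>, so after normalisation \<open>pos\<close> applies to it.\<close>

lemma eigen_combination_nonneg:
  fixes \<rho> \<gamma> V :: "complex mat" and l :: "nat \<Rightarrow> real" and \<alpha> \<kappa> \<mu> :: real and c :: "nat \<Rightarrow> complex"
  assumes V: "unitary_mat n V"
    and \<gamma>: "\<gamma> = V * mat_diag n (\<lambda>i. complex_of_real (l i)) * mat_adjoint V"
    and \<rho>: "\<rho> \<in> carrier_mat n n"
    and pos: "\<And>x a. unit_eigenvector \<gamma> x a \<Longrightarrow> 0 \<le> \<alpha> * expectation_value \<rho> x + \<kappa> * a"
    and supp: "\<And>j. j < n \<Longrightarrow> c j \<noteq> 0 \<Longrightarrow> l j = \<mu>"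
  shows "0 \<le> Re (\<Sum>j<n. \<Sum>k<n. c j * (complex_of_real \<alpha> * (mat_adjoint V * \<rho> * V) $$ (j, k)
    + complex_of_real \<kappa> * mat_diag n (\<lambda>i. complex_of_real (l i)) $$ (j, k)) * cnj (c k))"
proof -
  note VC = unitary_matD[OF V]
  let ?D = "mat_diag n (\<lambda>i. complex_of_real (l i))"
  let ?R = "mat_adjoint V * \<rho> * V"
  note as = assoc_mult_mat_vec[of _ n n _ n]
  have R: "?R \<in> carrier_mat n n" using VC \<rho> by (intro mult_carrier_mat[of _ n n]) auto
  have \<gamma>c: "\<gamma> \<in> carrier_mat n n" unfolding \<gamma> using VC by (intro mult_carrier_mat[of _ n n]) auto
  \<comment> \<open>The conjugation matches \<open>\<bullet>c\<close>, which conjugates its second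
    argument: the left coefficient \<open>c j\<close> has to come out as the conjugate of entry j of
    y.\<close>
  define y where "y = vec n (\<lambda>j. cnj (c j))"
  have y[simp]: "y \<in> carrier_vec n" by (simp add: y_def)
  have y_index: "y $ j = cnj (c j)" if "j < n" for j using that by (simp add: y_def)
  define x where "x = V *\<^sub>v y"
  have x[simp]: "x \<in> carrier_vec n" using VC by (simp add: x_def mult_mat_vec_carrier[of _ n n])
  define K where "K = (\<Sum>j<n. (cmod (c j))\<^sup>2)"
  have Vx: "mat_adjoint V *\<^sub>v x = y"
    unfolding x_def using VC by (subst as[symmetric]) auto
  have xx: "x \<bullet>c x = complex_of_real K"
  proof -
    have "x \<bullet>c x = y \<bullet>c y"
      by (subst x_def, subst cscalar_prod_adjoint[OF VC(1) y x]) (simp add: Vx)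
    also have "\<dots> = complex_of_real K"
      unfolding cscalar_prod_sum[OF y]
      by (simp add: y_def K_def complex_norm_square mult.commute del: of_real_power)
    finally show ?thesis .
  qed
  have Dy: "?D *\<^sub>v y = complex_of_real \<mu> \<cdot>\<^sub>v y"
  proof (rule eq_vecI)
    fix j assume "j < dim_vec (complex_of_real \<mu> \<cdot>\<^sub>v y)"
    then have j: "j < n" by (simp add: y_def)
    have "(?D *\<^sub>v y) $ j = (\<Sum>k<n. if k = j then complex_of_real (l j) * cnj (c j) else 0)"
      unfolding mult_vec_index[OF mat_diag_dim y j] using j
      by (intro sum.cong refl) (simp add: mat_diag_def y_def)
    also have "\<dots> = complex_of_real \<mu> * cnj (c j)"
      using j supp[OF j] by (cases "c j = 0") (simp_all add: sum.delta')
    finally show "(?D *\<^sub>v y) $ j = (complex_of_real \<mu> \<cdot>\<^sub>v y) $ j" using j by (simp add: y_def)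
  qed (simp add: y_def mat_diag_def)
  have \<gamma>x: "\<gamma> *\<^sub>v x = complex_of_real \<mu> \<cdot>\<^sub>v x"
  proof -
    have "\<gamma> *\<^sub>v x = V *\<^sub>v (?D *\<^sub>v (mat_adjoint V *\<^sub>v x))"
      unfolding \<gamma> using VC by (simp add: as mult_carrier_mat[of _ n n] Vx)
    also have "\<dots> = complex_of_real \<mu> \<cdot>\<^sub>v x"
      by (simp add: Vx Dy mult_mat_vec[OF VC(1) y] x_def[symmetric])
    finally show ?thesis .
  qed
  have form: "(\<Sum>j<n. \<Sum>k<n. c j * M $$ (j, k) * cnj (c k)) = (M *\<^sub>v y) \<bullet>c y"
    if "M \<in> carrier_mat n n" for M
    unfolding cscalar_prod_sum[OF y]
    by (intro sum.cong refl) (simp add: mult_vec_index[OF that y] y_index sum_distrib_left sum_distrib_right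
        ac_simps del: index_mult_mat_vec)
  have Ry: "(?R *\<^sub>v y) \<bullet>c y = (\<rho> *\<^sub>v x) \<bullet>c x"
  proof -
    have "?R *\<^sub>v y = mat_adjoint V *\<^sub>v (\<rho> *\<^sub>v x)"
      unfolding x_def using VC \<rho> by (simp add: as mult_carrier_mat[of _ n n] mult_mat_vec_carrier[of _ n n])
    then show ?thesis
      using cscalar_prod_adjoint[OF adjoint_carrier[OF VC(1)] mult_mat_vec_carrier[OF \<rho> x] y]
      by (simp add: x_def)
  qed
  have Dyy: "(?D *\<^sub>v y) \<bullet>c y = complex_of_real (\<mu> * K)"
  proof -
    have "y \<bullet>c y = complex_of_real K"
      using cscalar_prod_adjoint[OF VC(1) y x] xx unfolding x_def[symmetric] Vx by simp
    then show ?thesis unfolding Dy by (simp add: y_def)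
  qed
  have "(\<Sum>j<n. \<Sum>k<n. c j * (complex_of_real \<alpha> * ?R $$ (j, k) + complex_of_real \<kappa> * ?D $$ (j, k)) * cnj (c k))
      = complex_of_real \<alpha> * (\<Sum>j<n. \<Sum>k<n. c j * ?R $$ (j, k) * cnj (c k))
        + complex_of_real \<kappa> * (\<Sum>j<n. \<Sum>k<n. c j * ?D $$ (j, k) * cnj (c k))"
    by (simp only: distrib_left distrib_right sum.distrib sum_distrib_left mult.assoc mult.left_commute)
  also have "\<dots> = complex_of_real \<alpha> * ((\<rho> *\<^sub>v x) \<bullet>c x) + complex_of_real (\<kappa> * (\<mu> * K))"
    by (simp add: form[OF R] form[OF mat_diag_dim] Ry Dyy)
  finally have eq: "Re (\<Sum>j<n. \<Sum>k<n. c j * (complex_of_real \<alpha> * ?R $$ (j, k)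
      + complex_of_real \<kappa> * ?D $$ (j, k)) * cnj (c k)) = \<alpha> * expectation_value \<rho> x + \<kappa> * (\<mu> * K)"
    by (simp add: expectation_value_def)
  show ?thesis
  \<comment> \<open>K is the squared norm of x. If it vanishes, so do all coefficients; otherwise x
    can be scaled to a unit eigenvector.\<close>
  proof (cases "K = 0")
    case True
    then have "c j = 0" if "j < n" for j
      using that sum_nonneg_eq_0_iff[of "{..<n}" "\<lambda>j. (cmod (c j))\<^sup>2"] by (auto simp: K_def)
    then show ?thesis by simp
  next
    case False
    have "0 \<le> K" unfolding K_def by (rule sum_nonneg) simp
    with False have K: "0 < K" by simp
    define z where "z = complex_of_real (1 / sqrt K) \<cdot>\<^sub>v x"
    have z: "z \<in> carrier_vec n" by (simp add: z_def)
    \<comment> \<open>Kept for general A: the identity yields the norm of z, and \<rho> its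
      expectation value.\<close>
    have sc: "(A *\<^sub>v z) \<bullet>c z = complex_of_real (1 / K) * ((A *\<^sub>v x) \<bullet>c x)"
      if A: "A \<in> carrier_mat n n" for A
    proof -
      have "A *\<^sub>v z = complex_of_real (1 / sqrt K) \<cdot>\<^sub>v (A *\<^sub>v x)"
        unfolding z_def by (rule mult_mat_vec[OF A x])
      then have "(A *\<^sub>v z) \<bullet>c z
          = complex_of_real (1 / sqrt K * (1 / sqrt K)) * ((A *\<^sub>v x) \<bullet>c x)"
        unfolding z_def by (simp only: cscalar_prod_smult[OF mult_mat_vec_carrier[OF A x] x] complex_cnj_complex_of_real of_real_mult)
      also have "1 / sqrt K * (1 / sqrt K) = 1 / K" using K by simp
      finally show ?thesis .
    qed
    have "z \<bullet>c z = 1" using sc[OF one_carrier_mat] z K by (simp add: xx)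
    moreover have "z \<noteq> 0\<^sub>v n"
      using \<open>z \<bullet>c z = 1\<close> by (metis conjugate_square_eq_0_vec z zero_neq_one)
    moreover have "\<gamma> *\<^sub>v z = complex_of_real \<mu> \<cdot>\<^sub>v z"
      unfolding z_def by (simp add: mult_mat_vec[OF \<gamma>c x] \<gamma>x smult_smult_assoc mult.commute)
    ultimately have "unit_eigenvector \<gamma> z \<mu>"
      using z \<gamma>c by (auto simp: unit_eigenvector_def eigenvector_def)
    from pos[OF this] have "0 \<le> K * (\<alpha> * expectation_value \<rho> z + \<kappa> * \<mu>)" using K by simp
    also have "expectation_value \<rho> z = expectation_value \<rho> x / K"
      by (simp add: expectation_value_def sc[OF \<rho>])
    finally show ?thesis unfolding eq using K by (simp add: algebra_simps)
  qed
qed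

text \<open>An eigenvector of the tensor product with a diagonal state is a superposition of products
  whose first factors are eigenvectors.\<close>

lemma product_eigen_combination_nonneg:
  fixes \<rho> \<gamma> V :: "complex mat" and l g :: "nat \<Rightarrow> real" and \<alpha> \<kappa> \<mu> :: real and c :: "nat \<Rightarrow> complex"
    and n m :: nat
  defines "D \<equiv> mat_diag n (\<lambda>i. complex_of_real (l i))"
    and "E \<equiv> mat_diag m (\<lambda>i. complex_of_real (g i))"
  assumes V: "unitary_mat n V" and \<gamma>: "\<gamma> = V * D * mat_adjoint V"
    and \<rho>: "\<rho> \<in> carrier_mat n n"
    and g: "\<And>k. k < m \<Longrightarrow> 0 \<le> g k"
    and pos: "\<And>x a. unit_eigenvector \<gamma> x a \<Longrightarrow> 0 \<le> \<alpha> * expectation_value \<rho> x + \<kappa> * a"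
    and supp: "\<And>a. a < n * m \<Longrightarrow> c a \<noteq> 0 \<Longrightarrow> kronecker D E $$ (a, a) = complex_of_real \<mu>"
  shows "0 \<le> Re (\<Sum>a<n * m. \<Sum>b<n * m. c a *
    (complex_of_real \<alpha> * kronecker (mat_adjoint V * \<rho> * V) E $$ (a, b)
      + complex_of_real \<kappa> * kronecker D E $$ (a, b)) * cnj (c b))"
proof -
  note VC = unitary_matD[OF V]
  let ?R = "mat_adjoint V * \<rho> * V"
  have R: "?R \<in> carrier_mat n n" using VC \<rho> by (intro mult_carrier_mat[of _ n n]) auto
  have D: "D \<in> carrier_mat n n" and E: "E \<in> carrier_mat m m" by (simp_all add: D_def E_def)
  have E_index: "E $$ (k, k') = (if k = k' then complex_of_real (g k) else 0)" if "k < m" "k' < m" for k k'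
    using that by (simp add: E_def mat_diag_def)
  define M where "M j j' = complex_of_real \<alpha> * ?R $$ (j, j') + complex_of_real \<kappa> * D $$ (j, j')" for j j'
  \<comment> \<open>Since E is diagonal, only equal second indices survive; the form becomes a sum
    over k of forms on the first factor with weights \<open>g k\<close>.\<close>
  have "(\<Sum>a<n * m. \<Sum>b<n * m. c a * (complex_of_real \<alpha> * kronecker ?R E $$ (a, b)
      + complex_of_real \<kappa> * kronecker D E $$ (a, b)) * cnj (c b))
    = (\<Sum>j<n. \<Sum>k<m. \<Sum>j'<n. \<Sum>k'<m. if k = k'
        then complex_of_real (g k) * (c (j * m + k) * M j j' * cnj (c (j' * m + k))) else 0)"
    unfolding sum_pair_index
    by (intro sum.cong refl)
      (simp add: kronecker_index[OF R E] kronecker_index[OF D E] M_def E_index, simp add: algebra_simps)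
  also have "\<dots> = (\<Sum>j<n. \<Sum>k<m. \<Sum>j'<n.
      complex_of_real (g k) * (c (j * m + k) * M j j' * cnj (c (j' * m + k))))"
    by simp
  also have "\<dots> = (\<Sum>k<m. complex_of_real (g k) *
      (\<Sum>j<n. \<Sum>j'<n. c (j * m + k) * M j j' * cnj (c (j' * m + k))))"
    by (subst sum.swap) (simp add: sum_distrib_left)
  finally have eq: "Re (\<Sum>a<n * m. \<Sum>b<n * m. c a * (complex_of_real \<alpha> * kronecker ?R E $$ (a, b)
      + complex_of_real \<kappa> * kronecker D E $$ (a, b)) * cnj (c b))
    = (\<Sum>k<m. g k * Re (\<Sum>j<n. \<Sum>j'<n. c (j * m + k) * M j j' * cnj (c (j' * m + k))))"
    by simp
  have "0 \<le> g k * Re (\<Sum>j<n. \<Sum>j'<n. c (j * m + k) * M j j' * cnj (c (j' * m + k)))" if k: "k < m" for k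
  \<comment> \<open>A vanishing weight removes the term; otherwise the coefficients with second
    index k are supported on the single eigenvalue \<open>\<mu> / g k\<close> of the first
    factor.\<close>
  proof (cases "g k = 0")
    case False
    have "0 \<le> Re (\<Sum>j<n. \<Sum>j'<n. c (j * m + k) * M j j' * cnj (c (j' * m + k)))"
      unfolding M_def unfolding D_def
    proof (rule eigen_combination_nonneg[OF V \<gamma>[unfolded D_def] \<rho> pos, where \<mu> = "\<mu> / g k"])
      fix j assume j: "j < n" and "c (j * m + k) \<noteq> 0"
      then have "kronecker D E $$ (j * m + k, j * m + k) = complex_of_real \<mu>"
        using supp pair_index_less[OF j k] by blast
      then have "complex_of_real (l j * g k) = complex_of_real \<mu>"
        by (simp add: kronecker_index[OF D E j k j k]) (simp add: D_def E_def mat_diag_def j k)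
      then have "l j * g k = \<mu>" by (simp only: of_real_eq_iff)
      then show "l j = \<mu> / g k" using False by (auto simp: field_simps)
    qed
    then show ?thesis using g[OF k] by simp
  qed simp
  then show ?thesis unfolding eq by (intro sum_nonneg) auto
qed

section \<open>Level occupations as traces\<close>

lemma kronecker_diag:
  "kronecker (mat_diag n f) (mat_diag m g) = mat_diag (n * m) (\<lambda>a. f (a div m) * g (a mod m))"
proof (rule kronecker_eqI[symmetric])
  fix i k j l assume *: "i < n" "k < m" "j < n" "l < m"
  then show "mat_diag (n * m) (\<lambda>a. f (a div m) * g (a mod m)) $$ (i * m + k, j * m + l)
      = mat_diag n f $$ (i, j) * mat_diag m g $$ (k, l)"
    using pair_index_eq_iff[OF *(2,4), of i j] by (simp add: mat_diag_def pair_index_less)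
qed simp_all

lemma reduced_state_index:
  assumes "A \<in> carrier_mat (N * d) (N * d)" "p < d" "q < d"
  shows "reduced_state d A $$ (p, q) = (\<Sum>i<N. A $$ (i * d + p, i * d + q))"
  using assms by (simp add: reduced_state_def)

text \<open>For p < d this is the orthogonal projection onto basis state p of the last factor.
  Writing an occupation as a trace against it opens the way to cyclicity and to changes of basis in
  the other factors.\<close>

definition level_projection :: "nat \<Rightarrow> nat \<Rightarrow> nat \<Rightarrow> complex mat" where
  "level_projection N d p = kronecker (1\<^sub>m N) (mat_diag d (\<lambda>k. if k = p then 1 else 0))"

lemma level_projection_carrier [simp]: "level_projection N d p \<in> carrier_mat (N * d) (N * d)"
  by (simp add: level_projection_def)

lemma reduced_state_trace:
  assumes A: "A \<in> carrier_mat (N * d) (N * d)" and p: "p < d"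
  shows "reduced_state d A $$ (p, p) = mat_trace (level_projection N d p * A)"
proof -
  have "level_projection N d p = mat_diag (N * d) (\<lambda>a. if a mod d = p then 1 else 0)"
    unfolding level_projection_def mat_diag_one[symmetric] kronecker_diag by simp
  then have "mat_trace (level_projection N d p * A)
      = (\<Sum>a<N * d. if a mod d = p then A $$ (a, a) else 0)"
    using A by (simp add: mat_diag_mult_left mat_trace_def if_distrib[of "\<lambda>x. x * _"] cong: if_cong)
  also have "\<dots> = (\<Sum>i<N. A $$ (i * d + p, i * d + p))"
    unfolding sum_pair_index using p by (intro sum.cong refl) (simp add: sum.delta)
  finally show ?thesis using reduced_state_index[OF A p p] by simp
qed

lemma conj_unitary_cancel:
  assumes W: "unitary_mat n W" and A: "A \<in> carrier_mat n n"
  shows "W * (mat_adjoint W * A * W) * mat_adjoint W = A"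
proof -
  note WC = unitary_matD[OF W]
  note [simp] = WC A mult_carrier_mat[of _ n n _ n]
  have "W * (mat_adjoint W * A * W) * mat_adjoint W = (W * mat_adjoint W) * A * (W * mat_adjoint W)"
    by (simp add: assoc_mult_mat[of _ n n _ n _ n] del: WC(2,3))
  then show ?thesis by (simp add: left_mult_one_mat[of _ n n] right_mult_one_mat[of _ n n])
qed

text \<open>Once P has moved past W, cyclicity of the trace brings W and its adjoint together.
  Passing to an eigenbasis of the first two factors therefore leaves level occupations
  unchanged.\<close>

lemma trace_conj_commute:
  assumes W: "unitary_mat n W" and P: "P \<in> carrier_mat n n" and comm: "P * W = W * P"
    and B: "B \<in> carrier_mat n n"
  shows "mat_trace (P * (W * B * mat_adjoint W)) = mat_trace (P * B)"
proof -
  note WC = unitary_matD[OF W]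
  note [simp] = WC P B mult_carrier_mat[of _ n n _ n]
  note as = assoc_mult_mat[of _ n n _ n _ n]
  have "P * (W * B * mat_adjoint W) = W * (P * B * mat_adjoint W)"
    by (simp add: as[symmetric] comm)
  also have "mat_trace \<dots> = mat_trace (P * B * mat_adjoint W * W)"
    by (rule trace_comm[of _ n n]) auto
  also have "P * B * mat_adjoint W * W = P * B" by (simp add: as right_mult_one_mat[of _ n n])
  finally show ?thesis .
qed

text \<open>A unitary commuting with the diagonal matrix T connects only indices with equal entries
  of T. Restricted to one level, each of its rows is hence supported where \<Lambda> is constant,
  and \<open>low\<close> and \<open>high\<close> give the signs that
  \<open>block_diagonal_transfer\<close> asks for with G = R - \<kappa> T. As T is invariant under
  u, its contribution cancels and an estimate for R remains.\<close>

lemma frame_transfer: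
  fixes S u :: "complex mat" and \<Lambda> w \<tau> :: "nat \<Rightarrow> real" and N p q :: nat
  defines "T\<^sub>0 \<equiv> mat_diag N (\<lambda>a. complex_of_real (\<Lambda> a))"
  defines "R \<equiv> kronecker S (mat_diag 2 (\<lambda>k. complex_of_real (w k)))"
    and "T \<equiv> kronecker T\<^sub>0 (mat_diag 2 (\<lambda>k. complex_of_real (\<tau> k)))"
  assumes S: "S \<in> carrier_mat N N" and u: "unitary_mat (N * 2) u" and comm: "u * T = T * u"
    and pq: "{p, q} = {0, 1}" and \<tau>: "\<And>k. k < 2 \<Longrightarrow> \<tau> k > 0"
    and low: "\<And>c \<mu>. (\<And>a. a < N \<Longrightarrow> c a \<noteq> 0 \<Longrightarrow> \<Lambda> a = \<mu>) \<Longrightarrow>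
      0 \<le> Re (\<Sum>a<N. \<Sum>b<N. c a * (complex_of_real (w q) * S $$ (a, b)
        + complex_of_real (- \<kappa> * \<tau> q) * T\<^sub>0 $$ (a, b)) * cnj (c b))"
    and high: "\<And>c \<mu>. (\<And>a. a < N \<Longrightarrow> c a \<noteq> 0 \<Longrightarrow> \<Lambda> a = \<mu>) \<Longrightarrow>
      0 \<le> Re (\<Sum>a<N. \<Sum>b<N. c a * (complex_of_real (- w p) * S $$ (a, b)
        + complex_of_real (\<kappa> * \<tau> p) * T\<^sub>0 $$ (a, b)) * cnj (c b))"
  shows "Re (\<Sum>i<N. R $$ (i * 2 + p, i * 2 + p)) \<le> Re (\<Sum>i<N. (u * R * mat_adjoint u) $$ (i * 2 + p, i * 2 + p))"
proof -
  note uC = unitary_matD[OF u]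
  have p2: "p < 2" and q2: "q < 2" and pq': "p \<noteq> q" using pq by (auto simp: doubleton_eq_iff)
  have T\<^sub>0: "T\<^sub>0 \<in> carrier_mat N N" by (simp add: T\<^sub>0_def)
  have R: "R \<in> carrier_mat (N * 2) (N * 2)" using S by (simp add: R_def)
  have T: "T \<in> carrier_mat (N * 2) (N * 2)" using T\<^sub>0 by (simp add: T_def)
  define d where "d a = \<Lambda> (a div 2) * \<tau> (a mod 2)" for a
  have Td: "T = mat_diag (N * 2) (\<lambda>a. complex_of_real (d a))"
    by (simp add: T_def T\<^sub>0_def kronecker_diag d_def)
  have supp: "d a = d i" if "u $$ (i, a) \<noteq> 0" "i < N * 2" "a < N * 2" for i a
  proof -
    have "(u * T) $$ (i, a) = (T * u) $$ (i, a)" by (simp add: comm)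
    then have "u $$ (i, a) * complex_of_real (d a) = complex_of_real (d i) * u $$ (i, a)"
      unfolding Td using that(2,3) uC(1) by (simp add: mat_diag_mult_left mat_diag_mult_right)
    then show ?thesis using that(1) by (metis mult.commute mult_cancel_left of_real_eq_iff)
  qed
  define G where "G a b = R $$ (a, b) - complex_of_real \<kappa> * T $$ (a, b)" for a b
  \<comment> \<open>The indices whose last tensor digit is r; \<open>I q\<close> and
    \<open>I p\<close> take the roles of L and H.\<close>
  define I where "I r = (\<lambda>a. a * 2 + r) ` {..<N}" for r :: nat
  have inj: "inj_on (\<lambda>a. a * 2 + r) {..<N}" for r :: nat by (auto simp: inj_on_def)
  have sum_I: "sum f (I r) = (\<Sum>a<N. f (a * 2 + r))" for f :: "nat \<Rightarrow> complex" and r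
    unfolding I_def by (subst sum.reindex[OF inj]) simp
  have I_less: "a < N * 2" if "a \<in> I r" "r < 2" for a r
    using that pair_index_less[of _ N r 2] by (auto simp: I_def)
  have I_union: "I q \<union> I p = {..<N * 2}"
  proof
    show "{..<N * 2} \<subseteq> I q \<union> I p"
    proof
      fix a assume "a \<in> {..<N * 2}"
      then have "a div 2 \<in> {..<N}" "a mod 2 \<in> {p, q}" unfolding pq by auto
      then show "a \<in> I q \<union> I p" unfolding I_def by (auto simp: image_iff intro!: bexI[of _ "a div 2"])
    qed
  qed (use I_less p2 q2 in auto)
  have I_disj: "I q \<inter> I p = {}"
    using p2 q2 pq' pair_index_eq_iff[of q 2 p] by (auto simp: I_def)
  have G_index: "G (a * 2 + r) (b * 2 + r') = (if r = r' then
      complex_of_real (w r) * S $$ (a, b) - complex_of_real (\<kappa> * \<tau> r) * T\<^sub>0 $$ (a, b) else 0)"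
    if "a < N" "b < N" "r < 2" "r' < 2" for a b r r'
    using that unfolding G_def R_def T_def
    by (simp add: kronecker_index[OF S] kronecker_index[OF T\<^sub>0] mat_diag_def)
  have block_supp: "\<Lambda> a = d i / \<tau> r" if "u $$ (i, a * 2 + r) \<noteq> 0" "a < N" "r < 2" "i < N * 2" for a r i
  proof -
    have "d (a * 2 + r) = d i" using supp[OF that(1,4)] pair_index_less[OF that(2,3)] by simp
    then show ?thesis using \<tau>[OF that(3)] that(3) by (simp add: d_def field_simps)
  qed
  have block: "(\<Sum>a\<in>I r. \<Sum>b\<in>I r. u $$ (i, a) * G a b * cnj (u $$ (i, b)))
      = (\<Sum>a<N. \<Sum>b<N. u $$ (i, a * 2 + r) * (complex_of_real (w r) * S $$ (a, b)
        - complex_of_real (\<kappa> * \<tau> r) * T\<^sub>0 $$ (a, b)) * cnj (u $$ (i, b * 2 + r)))"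
    if "r < 2" for i r
    unfolding sum_I using that by (intro sum.cong refl) (simp add: G_index)
  have "Re (\<Sum>a\<in>I p. G a a)
      \<le> Re (\<Sum>i\<in>I p. \<Sum>a\<in>I q \<union> I p. \<Sum>b\<in>I q \<union> I p. u $$ (i, a) * G a b * cnj (u $$ (i, b)))"
  proof (rule block_diagonal_transfer[OF _ _ I_disj])
    show "finite (I q)" "finite (I p)" by (auto simp: I_def)
  next
    fix a b assume "a \<in> I p" "b \<in> I p"
    then have ab: "a < N * 2" "b < N * 2" using I_less p2 by auto
    have "(\<Sum>i<N * 2. u $$ (i, a) * cnj (u $$ (i, b))) = (mat_adjoint u * u) $$ (b, a)"
      unfolding mult_index[OF adjoint_carrier[OF uC(1)] uC(1) ab(2,1)]
      using uC(1) ab by (intro sum.cong) auto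
    then show "(\<Sum>i\<in>I q \<union> I p. u $$ (i, a) * cnj (u $$ (i, b))) = (if a = b then 1 else 0)"
      unfolding I_union uC(3) using ab by simp
  next
    fix a b assume "a \<in> I q" "b \<in> I p"
    then show "G a b = 0 \<and> G b a = 0"
      using p2 q2 pq' by (auto simp: I_def G_index)
  next
    fix i assume "i \<in> I p"
    then have i: "i < N * 2" using I_less p2 by auto
    show "0 \<le> Re (\<Sum>a\<in>I q. \<Sum>b\<in>I q. u $$ (i, a) * G a b * cnj (u $$ (i, b)))"
      unfolding block[OF q2]
      using low[of "\<lambda>a. u $$ (i, a * 2 + q)" "d i / \<tau> q"] block_supp[OF _ _ q2 i] by simp
  next
    fix i assume "i \<in> I q"
    then have i: "i < N * 2" using I_less q2 by auto
    have "0 \<le> Re (\<Sum>a<N. \<Sum>b<N. u $$ (i, a * 2 + p) * (complex_of_real (- w p) * S $$ (a, b)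
        + complex_of_real (\<kappa> * \<tau> p) * T\<^sub>0 $$ (a, b)) * cnj (u $$ (i, b * 2 + p)))"
      by (rule high) (rule block_supp[OF _ _ p2 i])
    also have "\<dots> = - Re (\<Sum>a\<in>I p. \<Sum>b\<in>I p. u $$ (i, a) * G a b * cnj (u $$ (i, b)))"
      unfolding block[OF p2] uminus_complex.sel(1)[symmetric] sum_negf[symmetric]
      by (intro arg_cong[of _ _ Re] sum.cong refl) (simp add: algebra_simps)
    finally show "Re (\<Sum>a\<in>I p. \<Sum>b\<in>I p. u $$ (i, a) * G a b * cnj (u $$ (i, b))) \<le> 0" by simp
  qed
  also have "(\<Sum>i\<in>I p. \<Sum>a\<in>I q \<union> I p. \<Sum>b\<in>I q \<union> I p. u $$ (i, a) * G a b * cnj (u $$ (i, b)))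
      = (\<Sum>i\<in>I p. (u * R * mat_adjoint u) $$ (i, i) - complex_of_real \<kappa> * T $$ (i, i))"
    unfolding I_union
  proof (rule sum.cong[OF refl])
    fix i assume "i \<in> I p"
    then have i: "i < N * 2" using I_less p2 by auto
    \<comment> \<open>Conservation of T: its form at row i of u is just its diagonal entry, so both
      sides of the estimate contain the same multiple of the trace of T over level p.\<close>
    have "u * T * mat_adjoint u = T * (u * mat_adjoint u)"
      unfolding comm using T uC(1) by (intro assoc_mult_mat[of _ "N * 2" "N * 2" _ "N * 2" _ "N * 2"]) auto
    then have "u * T * mat_adjoint u = T" using T uC(2) by simp
    then have "T $$ (i, i) = (\<Sum>a<N * 2. \<Sum>b<N * 2. u $$ (i, a) * T $$ (a, b) * cnj (u $$ (i, b)))"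
      using mult_adjoint_diag_index[OF uC(1) T i] by simp
    then show "(\<Sum>a<N * 2. \<Sum>b<N * 2. u $$ (i, a) * G a b * cnj (u $$ (i, b)))
      = (u * R * mat_adjoint u) $$ (i, i) - complex_of_real \<kappa> * T $$ (i, i)"
      unfolding mult_adjoint_diag_index[OF uC(1) R i]
      by (simp add: G_def algebra_simps sum_subtractf sum_distrib_left)
  qed
  finally show ?thesis by (simp add: sum_I G_def sum_subtractf)
qed

section \<open>Spectra of density matrices\<close>

lemma spectral_form:
  fixes A V :: "complex mat" and d :: "nat \<Rightarrow> real"
  assumes V: "unitary_mat n V" and A: "A = V * mat_diag n (\<lambda>i. complex_of_real (d i)) * mat_adjoint V"
    and x: "x \<in> carrier_vec n"
  shows "A *\<^sub>v x = V *\<^sub>v vec n (\<lambda>i. complex_of_real (d i) * (mat_adjoint V *\<^sub>v x) $ i)"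
    and "(A *\<^sub>v x) \<bullet>c x = complex_of_real (\<Sum>i<n. d i * (cmod ((mat_adjoint V *\<^sub>v x) $ i))\<^sup>2)"
    and "x \<bullet>c x = complex_of_real (\<Sum>i<n. (cmod ((mat_adjoint V *\<^sub>v x) $ i))\<^sup>2)"
proof -
  note VC = unitary_matD[OF V]
  let ?D = "mat_diag n (\<lambda>i. complex_of_real (d i))"
  define y where "y = mat_adjoint V *\<^sub>v x"
  have y: "y \<in> carrier_vec n" using VC x by (simp add: y_def mult_mat_vec_carrier[of _ n n])
  have x_eq: "V *\<^sub>v y = x"
    unfolding y_def using VC x by (subst assoc_mult_mat_vec[of _ n n _ n, symmetric]) auto
  define Dy where "Dy = vec n (\<lambda>i. complex_of_real (d i) * y $ i)"
  have Dy: "Dy \<in> carrier_vec n" by (simp add: Dy_def)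
  have "?D *\<^sub>v y = Dy"
  proof (rule eq_vecI)
    fix i assume "i < dim_vec Dy"
    then have i: "i < n" by (simp add: Dy_def)
    have "(?D *\<^sub>v y) $ i = (\<Sum>k<n. if i = k then complex_of_real (d k) * y $ k else 0)"
      unfolding mult_vec_index[OF mat_diag_dim y i] using i
      by (intro sum.cong refl) (simp add: mat_diag_def)
    then show "(?D *\<^sub>v y) $ i = Dy $ i" using i by (simp add: Dy_def)
  qed (simp add: Dy_def mat_diag_def)
  moreover have "A *\<^sub>v x = V *\<^sub>v (?D *\<^sub>v y)"
    unfolding A using VC x y
    by (simp add: assoc_mult_mat_vec[of _ n n _ n] mult_carrier_mat[of _ n n] y_def[symmetric])
  ultimately have Ax: "A *\<^sub>v x = V *\<^sub>v Dy" by simp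
  then show "A *\<^sub>v x = V *\<^sub>v vec n (\<lambda>i. complex_of_real (d i) * (mat_adjoint V *\<^sub>v x) $ i)"
    by (simp add: Dy_def y_def)
  have "(A *\<^sub>v x) \<bullet>c x = Dy \<bullet>c y"
    unfolding Ax y_def by (rule cscalar_prod_adjoint[OF VC(1) Dy x])
  also have "\<dots> = complex_of_real (\<Sum>i<n. d i * (cmod (y $ i))\<^sup>2)"
    unfolding cscalar_prod_sum[OF y] of_real_sum of_real_mult complex_norm_square
    by (intro sum.cong refl) (simp add: Dy_def)
  finally show "(A *\<^sub>v x) \<bullet>c x = complex_of_real (\<Sum>i<n. d i * (cmod ((mat_adjoint V *\<^sub>v x) $ i))\<^sup>2)"
    by (simp add: y_def)
  have "x \<bullet>c x = y \<bullet>c y"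
    using cscalar_prod_adjoint[OF VC(1) y x] by (simp add: x_eq y_def[symmetric])
  also have "\<dots> = complex_of_real (\<Sum>i<n. (cmod (y $ i))\<^sup>2)"
    unfolding cscalar_prod_sum[OF y] of_real_sum of_real_mult complex_norm_square by simp
  finally show "x \<bullet>c x = complex_of_real (\<Sum>i<n. (cmod ((mat_adjoint V *\<^sub>v x) $ i))\<^sup>2)"
    by (simp add: y_def)
qed

lemma mult_mat_vec_zero:
  fixes A :: "complex mat"
  assumes "A \<in> carrier_mat n m"
  shows "A *\<^sub>v 0\<^sub>v m = 0\<^sub>v n"
  using assms by (auto intro!: eq_vecI)

text \<open>The i-th eigenvalue is the quadratic form of \<rho> at the i-th column of V, so
  positivity of \<rho> makes it nonnegative. If it were 0, that column would be a nonzero kernel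
  vector, which full rank excludes through the determinant.\<close>

lemma density_spectrum:
  assumes \<rho>: "density_matrix n \<rho>"
  obtains V d where "unitary_mat n V" "\<rho> = V * mat_diag n (\<lambda>i. complex_of_real (d i)) * mat_adjoint V"
    "\<And>i. i < n \<Longrightarrow> 0 \<le> d i" "full_rank n \<rho> \<Longrightarrow> (\<And>i. i < n \<Longrightarrow> 0 < d i)"
proof -
  have \<rho>c: "\<rho> \<in> carrier_mat n n" "mat_adjoint \<rho> = \<rho>"
    and psd: "\<And>x. x \<in> carrier_vec n \<Longrightarrow> 0 \<le> (\<rho> *\<^sub>v x) \<bullet>c x"
    using \<rho> by (auto simp: density_matrix_def)
  from hermitian_spectral[OF \<rho>c] obtain V d where V: "unitary_mat n V"
    and eq: "\<rho> = V * mat_diag n (\<lambda>i. complex_of_real (d i)) * mat_adjoint V" by blast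
  note VC = unitary_matD[OF V]
  define x where "x i = V *\<^sub>v unit_vec n i" for i
  have x: "x i \<in> carrier_vec n" for i using VC by (simp add: x_def mult_mat_vec_carrier[of _ n n])
  have Vx: "mat_adjoint V *\<^sub>v x i = unit_vec n i" for i
    unfolding x_def using VC by (subst assoc_mult_mat_vec[of _ n n _ n, symmetric]) auto
  have nonneg: "0 \<le> d i" if "i < n" for i
  proof -
    have "(\<Sum>k<n. d k * (cmod (unit_vec n i $ k))\<^sup>2) = (\<Sum>k<n. if k = i then d k else 0)"
      using that by (intro sum.cong) auto
    then have "(\<rho> *\<^sub>v x i) \<bullet>c x i = complex_of_real (d i)"
      using that by (simp add: spectral_form(2)[OF V eq x] Vx)
    then show ?thesis using psd[OF x, of i] by (simp add: less_eq_complex_def)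
  qed
  have "0 < d i" if fr: "full_rank n \<rho>" and i: "i < n" for i
  proof -
    have "det \<rho> \<noteq> 0"
      using fr vec_space.det_rank_iff[OF \<rho>c(1)] by (simp add: full_rank_def)
    then have inj: "v = 0\<^sub>v n" if "v \<in> carrier_vec n" "\<rho> *\<^sub>v v = 0\<^sub>v n" for v
      using det_0_iff_vec_prod_zero_field[OF \<rho>c(1)] that by auto
    have "d i \<noteq> 0"
    proof
      assume "d i = 0"
      then have "vec n (\<lambda>k. complex_of_real (d k) * (mat_adjoint V *\<^sub>v x i) $ k) = 0\<^sub>v n"
        using i by (intro eq_vecI) (auto simp: Vx)
      then have "\<rho> *\<^sub>v x i = 0\<^sub>v n"
        unfolding spectral_form(1)[OF V eq x] using mult_mat_vec_zero[OF VC(1)] by simp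
      then have "x i = 0\<^sub>v n" using inj[OF x] by simp
      then have "unit_vec n i = (0\<^sub>v n :: complex vec)" using Vx[of i] mult_mat_vec_zero[OF adjoint_carrier[OF VC(1)]] by simp
      then show False using i by (metis index_unit_vec(2) index_zero_vec(1) zero_neq_one)
    qed
    then show ?thesis using nonneg[OF i] by simp
  qed
  then show ?thesis using that[OF V eq nonneg] by blast
qed

text \<open>In an eigenbasis the expectation value at a unit vector is a convex combination of the
  eigenvalues, which full rank makes positive. The bounds are uniform in x and thus bound the
  logarithms in the deviations.\<close>

lemma expectation_bounds:
  assumes \<rho>: "density_matrix n \<rho>" and fr: "full_rank n \<rho>"
  obtains lo hi where "0 < lo"
    "\<And>x. x \<in> carrier_vec n \<Longrightarrow> x \<bullet>c x = 1 \<Longrightarrow> lo \<le> expectation_value \<rho> x \<and> expectation_value \<rho> x \<le> hi"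
proof -
  from density_spectrum[OF \<rho>] fr obtain V d where V: "unitary_mat n V"
    and eq: "\<rho> = V * mat_diag n (\<lambda>i. complex_of_real (d i)) * mat_adjoint V"
    and pos: "\<And>i. i < n \<Longrightarrow> 0 < d i" by metis
  \<comment> \<open>Inserting 1 keeps the set nonempty also for n = 0 and leaves the minimum
    positive.\<close>
  define lo where "lo = Min (insert 1 (d ` {..<n}))"
  define hi where "hi = Max (insert 1 (d ` {..<n}))"
  have lo: "0 < lo" unfolding lo_def using pos by (subst Min_gr_iff) auto
  have d: "lo \<le> d i \<and> d i \<le> hi" if "i < n" for i
    unfolding lo_def hi_def using that by (auto intro!: Min_le Max_ge)
  have "lo \<le> expectation_value \<rho> x \<and> expectation_value \<rho> x \<le> hi" if x: "x \<in> carrier_vec n" "x \<bullet>c x = 1" for x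
  proof -
    define c where "c i = (cmod ((mat_adjoint V *\<^sub>v x) $ i))\<^sup>2" for i
    have "complex_of_real (\<Sum>i<n. c i) = complex_of_real 1"
      using spectral_form(3)[OF V eq x(1)] x(2) by (simp add: c_def)
    then have c: "(\<Sum>i<n. c i) = 1" by (simp only: of_real_eq_iff)
    have ev: "expectation_value \<rho> x = (\<Sum>i<n. d i * c i)"
      unfolding expectation_value_def spectral_form(2)[OF V eq x(1)] by (simp add: c_def)
    have "(\<Sum>i<n. lo * c i) \<le> (\<Sum>i<n. d i * c i)" "(\<Sum>i<n. d i * c i) \<le> (\<Sum>i<n. hi * c i)"
      using d by (auto intro!: sum_mono mult_right_mono simp: c_def)
    then show ?thesis unfolding ev by (simp add: sum_distrib_left[symmetric] c)
  qed
  with lo show ?thesis by (rule that)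
qed

section \<open>Unit eigenvectors and the obstruction to depleting a level\<close>

lemma unit_eigenvectorD:
  assumes "unit_eigenvector A x a" "A \<in> carrier_mat n n"
  shows "x \<in> carrier_vec n" "x \<bullet>c x = 1" "A *\<^sub>v x = complex_of_real a \<cdot>\<^sub>v x" "expectation_value A x = a"
proof -
  show *: "x \<in> carrier_vec n" "x \<bullet>c x = 1" "A *\<^sub>v x = complex_of_real a \<cdot>\<^sub>v x"
    using assms by (auto simp: unit_eigenvector_def eigenvector_def)
  show "expectation_value A x = a"
    unfolding expectation_value_def *(3) using *(1,2) by simp
qed

text \<open>Level 1 yields cooling and level 0 heating, so that one criterion, stated for either
  order of the levels, serves both.\<close>

definition usable_for_depleting :: "nat \<Rightarrow> thermo_object \<Rightarrow> thermo_object \<Rightarrow> bool" where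
  "usable_for_depleting p X Q \<longleftrightarrow>
     (\<exists>m Y u. equilibrium_object m Y \<and> allowed_unitary (X \<otimes>\<^sub>o Y \<otimes>\<^sub>o Q) u \<and>
        Re (reduced_state 2 (fst (transform u (X \<otimes>\<^sub>o Y \<otimes>\<^sub>o Q))) $$ (p, p))
          < Re (reduced_state 2 (fst (X \<otimes>\<^sub>o Y \<otimes>\<^sub>o Q)) $$ (p, p)))"

text \<open>The number \<kappa> separates the ratios of actual to equilibrium population carried by
  level q from those carried by level p. An auxiliary equilibrium state multiplies both populations
  by the same weights, so the separation survives on the total system. Conjugating with a product of
  diagonalising unitaries reduces the claim to \<open>frame_transfer\<close>.\<close>

lemma not_usable_for_depleting:
  fixes w \<tau> :: "nat \<Rightarrow> real"
  assumes X: "is_object n (\<rho>, \<gamma>)" and pq: "{p, q} = {0, 1}" and \<tau>: "\<And>k. k < 2 \<Longrightarrow> \<tau> k > 0"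
    and low: "\<And>x a. unit_eigenvector \<gamma> x a \<Longrightarrow> \<kappa> * \<tau> q * a \<le> w q * expectation_value \<rho> x"
    and high: "\<And>x a. unit_eigenvector \<gamma> x a \<Longrightarrow> w p * expectation_value \<rho> x \<le> \<kappa> * \<tau> p * a"
  shows "\<not> usable_for_depleting p (\<rho>, \<gamma>)
    (mat_diag 2 (\<lambda>k. complex_of_real (w k)), mat_diag 2 (\<lambda>k. complex_of_real (\<tau> k)))"
proof
  let ?w = "mat_diag 2 (\<lambda>k. complex_of_real (w k))" and ?\<tau> = "mat_diag 2 (\<lambda>k. complex_of_real (\<tau> k))"
  assume "usable_for_depleting p (\<rho>, \<gamma>) (?w, ?\<tau>)"
  then obtain m \<eta> u where \<eta>: "is_object m (\<eta>, \<eta>)"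
    and au: "allowed_unitary ((\<rho>, \<gamma>) \<otimes>\<^sub>o (\<eta>, \<eta>) \<otimes>\<^sub>o (?w, ?\<tau>)) u"
    and less: "Re (reduced_state 2 (fst (transform u ((\<rho>, \<gamma>) \<otimes>\<^sub>o (\<eta>, \<eta>) \<otimes>\<^sub>o (?w, ?\<tau>)))) $$ (p, p))
      < Re (reduced_state 2 (fst ((\<rho>, \<gamma>) \<otimes>\<^sub>o (\<eta>, \<eta>) \<otimes>\<^sub>o (?w, ?\<tau>))) $$ (p, p))"
    unfolding usable_for_depleting_def equilibrium_object_def by (metis prod.collapse)
  have dens: "density_matrix n \<gamma>" "density_matrix m \<eta>"
    and \<rho>c: "\<rho> \<in> carrier_mat n n" and \<gamma>c: "\<gamma> \<in> carrier_mat n n" and \<eta>c: "\<eta> \<in> carrier_mat m m"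
    using X \<eta> by (auto simp: is_object_def density_matrix_def)
  define N where "N = n * m"
  define \<sigma> where "\<sigma> = kronecker (kronecker \<rho> \<eta>) ?w"
  define \<Gamma> where "\<Gamma> = kronecker (kronecker \<gamma> \<eta>) ?\<tau>"
  have \<sigma>c: "\<sigma> \<in> carrier_mat (N * 2) (N * 2)" and \<Gamma>c: "\<Gamma> \<in> carrier_mat (N * 2) (N * 2)"
    using \<rho>c \<gamma>c \<eta>c by (simp_all add: \<sigma>_def \<Gamma>_def N_def)
  have u: "unitary_mat (N * 2) u" and comm: "u * \<Gamma> = \<Gamma> * u"
    using au carrier_matD(1)[OF \<Gamma>c]
    by (simp_all add: allowed_unitary_def object_times_def \<Gamma>_def)
  note uC = unitary_matD[OF u]
  have p2: "p < 2" using pq by (auto simp: doubleton_eq_iff)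
  let ?P = "level_projection N 2 p"
  have usu: "u * \<sigma> * mat_adjoint u \<in> carrier_mat (N * 2) (N * 2)"
    using uC \<sigma>c by (simp add: mult_carrier_mat[of _ "N * 2" "N * 2"])
  have less': "Re (mat_trace (?P * (u * \<sigma> * mat_adjoint u))) < Re (mat_trace (?P * \<sigma>))"
    using less unfolding reduced_state_trace[OF \<sigma>c p2, symmetric] reduced_state_trace[OF usu p2, symmetric]
    by (simp add: transform_def object_times_def \<sigma>_def)
  obtain V l where V: "unitary_mat n V"
    and \<gamma>: "\<gamma> = V * mat_diag n (\<lambda>i. complex_of_real (l i)) * mat_adjoint V"
    using density_spectrum[OF dens(1)] by metis
  obtain V' g where V': "unitary_mat m V'"
    and \<eta>': "\<eta> = V' * mat_diag m (\<lambda>i. complex_of_real (g i)) * mat_adjoint V'"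
    and g: "\<And>i. i < m \<Longrightarrow> 0 \<le> g i"
    using density_spectrum[OF dens(2)] by metis
  note VC = unitary_matD[OF V] and VC' = unitary_matD[OF V']
  let ?D = "mat_diag n (\<lambda>i. complex_of_real (l i))" and ?E = "mat_diag m (\<lambda>i. complex_of_real (g i))"
  \<comment> \<open>The qubit is diagonal from the start, so its factor is the identity; this makes
    W commute with the level projection.\<close>
  define W where "W = kronecker (kronecker V V') (1\<^sub>m 2)"
  have W: "unitary_mat (N * 2) W"
    unfolding W_def N_def using V V' by (intro unitary_kronecker) (auto simp: unitary_mat_def)
  note WC = unitary_matD[OF W]
  have WcA: "mat_adjoint W = kronecker (kronecker (mat_adjoint V) (mat_adjoint V')) (1\<^sub>m 2)"
    unfolding W_def kronecker_adjoint[OF kronecker_carrier[OF VC(1) VC'(1)] one_carrier_mat]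
      kronecker_adjoint[OF VC(1) VC'(1)] by simp
  define S where "S = kronecker (mat_adjoint V * \<rho> * V) ?E"
  define R where "R = kronecker S ?w"
  define T where "T = kronecker (kronecker ?D ?E) ?\<tau>"
  have Ve: "mat_adjoint V' * \<eta> * V' = ?E"
    unfolding \<eta>' using conj_unitary_cancel[OF unitary_mat_adjoint[OF V'] mat_diag_dim] by simp
  have Vg: "mat_adjoint V * \<gamma> * V = ?D"
    unfolding \<gamma> using conj_unitary_cancel[OF unitary_mat_adjoint[OF V] mat_diag_dim] by simp
  have conj3: "mat_adjoint W * kronecker (kronecker A \<eta>) B * W
      = kronecker (kronecker (mat_adjoint V * A * V) ?E) B"
    if A: "A \<in> carrier_mat n n" and B: "B \<in> carrier_mat 2 2" for A B
  proof -
    have [simp]: "mat_adjoint V * A \<in> carrier_mat n n" "mat_adjoint V' * \<eta> \<in> carrier_mat m m"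
      using VC VC' A \<eta>c by (auto intro!: mult_carrier_mat[of _ n n] mult_carrier_mat[of _ m m])
    have "mat_adjoint W * kronecker (kronecker A \<eta>) B
        = kronecker (kronecker (mat_adjoint V * A) (mat_adjoint V' * \<eta>)) B"
      unfolding WcA using VC VC' A B \<eta>c
      by (simp add: kronecker_mult[of _ "n * m" "n * m" _ 2 2 _ "n * m" _ 2]
          kronecker_mult[of _ n n _ m m _ n _ m] left_mult_one_mat[of _ 2 2])
    then show ?thesis
      unfolding W_def using VC VC' B
      by (simp add: kronecker_mult[of _ "n * m" "n * m" _ 2 2 _ "n * m" _ 2]
          kronecker_mult[of _ n n _ m m _ n _ m] right_mult_one_mat[of _ 2 2] Ve)
  qed
  have R: "mat_adjoint W * \<sigma> * W = R" unfolding \<sigma>_def R_def S_def by (rule conj3[OF \<rho>c]) simp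
  have T: "mat_adjoint W * \<Gamma> * W = T" unfolding \<Gamma>_def T_def Vg[symmetric] by (rule conj3[OF \<gamma>c]) simp
  define v where "v = mat_adjoint W * u * W"
  have v: "unitary_mat (N * 2) v"
    unfolding v_def using W u by (intro unitary_mat_mult unitary_mat_adjoint)
  note vC = unitary_matD[OF v]
  have S: "S \<in> carrier_mat N N"
    unfolding S_def N_def using VC \<rho>c by (simp add: mult_carrier_mat[of _ n n])
  have Rc: "R \<in> carrier_mat (N * 2) (N * 2)" and Tc: "T \<in> carrier_mat (N * 2) (N * 2)"
    using S by (simp_all add: R_def T_def N_def)
  note as = assoc_mult_mat[of _ "N * 2" "N * 2" _ "N * 2" _ "N * 2"]
    and cm = mult_carrier_mat[of _ "N * 2" "N * 2" _ "N * 2"]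
  have u_eq: "u = W * v * mat_adjoint W"
    unfolding v_def by (rule conj_unitary_cancel[OF W uC(1), symmetric])
  have \<sigma>_eq: "\<sigma> = W * R * mat_adjoint W"
    unfolding R[symmetric] by (rule conj_unitary_cancel[OF W \<sigma>c, symmetric])
  have conj_prod: "mat_adjoint W * (A * B) * W = (mat_adjoint W * A * W) * (mat_adjoint W * B * W)"
    if A: "A \<in> carrier_mat (N * 2) (N * 2)" and B: "B \<in> carrier_mat (N * 2) (N * 2)" for A B
  proof -
    have "(mat_adjoint W * A * W) * (mat_adjoint W * B * W) = mat_adjoint W * (A * ((W * mat_adjoint W) * (B * W)))"
      using A B WC(1) by (simp add: as cm)
    then show ?thesis using A B WC(1) by (simp add: WC(2) as cm left_mult_one_mat[of _ "N * 2" "N * 2"])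
  qed
  have vT: "v * T = T * v"
    unfolding v_def T[symmetric] conj_prod[OF uC(1) \<Gamma>c, symmetric] conj_prod[OF \<Gamma>c uC(1), symmetric] comm ..
  have "mat_adjoint W * (u * \<sigma> * mat_adjoint u) * W = v * R * (mat_adjoint W * mat_adjoint u * W)"
    using conj_prod[OF cm[OF uC(1) \<sigma>c] adjoint_carrier[OF uC(1)]] conj_prod[OF uC(1) \<sigma>c]
    by (simp add: v_def R)
  also have "mat_adjoint W * mat_adjoint u * W = mat_adjoint v"
    unfolding v_def using uC(1) WC(1)
    by (simp add: adjoint_mult[of _ "N * 2" "N * 2" _ "N * 2"] as cm)
  finally have usu_eq: "u * \<sigma> * mat_adjoint u = W * (v * R * mat_adjoint v) * mat_adjoint W"
    using conj_unitary_cancel[OF W usu] by simp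
  have PW: "?P * W = W * ?P"
    unfolding W_def level_projection_def N_def using VC VC'
    by (simp add: kronecker_mult[of _ "n * m" "n * m" _ 2 2 _ "n * m" _ 2]
        left_mult_one_mat[of _ 2 2] right_mult_one_mat[of _ 2 2]
        left_mult_one_mat[of _ "n * m" "n * m"] right_mult_one_mat[of _ "n * m" "n * m"])
  have vRv: "v * R * mat_adjoint v \<in> carrier_mat (N * 2) (N * 2)"
    using vC(1) Rc by (simp add: cm)
  have "Re (\<Sum>i<N. R $$ (i * 2 + p, i * 2 + p))
      \<le> Re (\<Sum>i<N. (v * R * mat_adjoint v) $$ (i * 2 + p, i * 2 + p))"
  proof -
    define \<Lambda> where "\<Lambda> a = l (a div m) * g (a mod m)" for a
    have DE: "kronecker ?D ?E = mat_diag N (\<lambda>a. complex_of_real (\<Lambda> a))"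
      by (simp add: kronecker_diag N_def \<Lambda>_def)
    \<comment> \<open>Serves both sign conditions: \<open>\<alpha> = w q\<close> with
      \<open>\<kappa>' = - \<kappa> * \<tau> q\<close> for level q, and
      \<open>\<alpha> = - w p\<close> with \<open>\<kappa>' = \<kappa> * \<tau> p\<close> for level
      p.\<close>
    have form: "0 \<le> Re (\<Sum>a<N. \<Sum>b<N. c a * (complex_of_real \<alpha> * S $$ (a, b)
        + complex_of_real \<kappa>' * mat_diag N (\<lambda>a. complex_of_real (\<Lambda> a)) $$ (a, b)) * cnj (c b))"
      if "\<And>x a. unit_eigenvector \<gamma> x a \<Longrightarrow> 0 \<le> \<alpha> * expectation_value \<rho> x + \<kappa>' * a"
        "\<And>a. a < N \<Longrightarrow> c a \<noteq> 0 \<Longrightarrow> \<Lambda> a = \<mu>" for c \<alpha> \<kappa>' \<mu>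
      unfolding S_def DE[symmetric] unfolding N_def
    proof (rule product_eigen_combination_nonneg[OF V \<gamma> \<rho>c g that(1)])
      fix a assume "a < n * m" "c a \<noteq> 0"
      then show "kronecker ?D ?E $$ (a, a) = complex_of_real \<mu>"
        unfolding DE using that(2) by (auto simp: N_def mat_diag_def)
    qed auto
    show ?thesis
      unfolding R_def
    proof (rule frame_transfer[OF S v _ pq \<tau>])
      show "v * kronecker (mat_diag N (\<lambda>a. complex_of_real (\<Lambda> a))) ?\<tau>
          = kronecker (mat_diag N (\<lambda>a. complex_of_real (\<Lambda> a))) ?\<tau> * v"
        using vT unfolding T_def DE .
    next
      fix c :: "nat \<Rightarrow> complex" and \<mu> assume "\<And>a. a < N \<Longrightarrow> c a \<noteq> 0 \<Longrightarrow> \<Lambda> a = \<mu>"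
      then show "0 \<le> Re (\<Sum>a<N. \<Sum>b<N. c a * (complex_of_real (w q) * S $$ (a, b)
          + complex_of_real (- \<kappa> * \<tau> q) * mat_diag N (\<lambda>a. complex_of_real (\<Lambda> a)) $$ (a, b)) * cnj (c b))"
        by (rule form[rotated]) (use low in auto)
    next
      fix c :: "nat \<Rightarrow> complex" and \<mu> assume "\<And>a. a < N \<Longrightarrow> c a \<noteq> 0 \<Longrightarrow> \<Lambda> a = \<mu>"
      then show "0 \<le> Re (\<Sum>a<N. \<Sum>b<N. c a * (complex_of_real (- w p) * S $$ (a, b)
          + complex_of_real (\<kappa> * \<tau> p) * mat_diag N (\<lambda>a. complex_of_real (\<Lambda> a)) $$ (a, b)) * cnj (c b))"
        by (rule form[rotated]) (use high in auto)
    qed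
  qed
  \<comment> \<open>Back to the original basis: the two sums are the occupations of level p before
    and after the transformation, since W commutes with the level projection.\<close>
  also have "(\<Sum>i<N. R $$ (i * 2 + p, i * 2 + p)) = mat_trace (?P * \<sigma>)"
    unfolding \<sigma>_eq trace_conj_commute[OF W level_projection_carrier PW Rc]
      reduced_state_trace[OF Rc p2, symmetric] reduced_state_index[OF Rc p2 p2] ..
  also have "(\<Sum>i<N. (v * R * mat_adjoint v) $$ (i * 2 + p, i * 2 + p))
      = mat_trace (?P * (u * \<sigma> * mat_adjoint u))"
    unfolding usu_eq trace_conj_commute[OF W level_projection_carrier PW vRv]
      reduced_state_trace[OF vRv p2, symmetric] reduced_state_index[OF vRv p2 p2] ..
  finally show False using less' by simp
qed

section \<open>Exchanging two eigenvectors\<close>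

text \<open>The rank-one operator |x><y| of Dirac notation.\<close>

definition outer :: "complex vec \<Rightarrow> complex vec \<Rightarrow> complex mat" where
  "outer x y = mat (dim_vec x) (dim_vec y) (\<lambda>(i, j). x $ i * cnj (y $ j))"

lemma outer_carrier [simp]: "x \<in> carrier_vec n \<Longrightarrow> y \<in> carrier_vec m \<Longrightarrow> outer x y \<in> carrier_mat n m"
  by (simp add: outer_def)

lemma outer_index:
  assumes "x \<in> carrier_vec n" "y \<in> carrier_vec m" "i < n" "j < m"
  shows "outer x y $$ (i, j) = x $ i * cnj (y $ j)"
  using assms by (simp add: outer_def)

lemma mult_outer:
  assumes A: "A \<in> carrier_mat n m" and x: "x \<in> carrier_vec m" and y: "y \<in> carrier_vec k"
  shows "A * outer x y = outer (A *\<^sub>v x) y"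
proof (rule eq_matI)
  fix i j assume "i < dim_row (outer (A *\<^sub>v x) y)" "j < dim_col (outer (A *\<^sub>v x) y)"
  then have ij: "i < n" "j < k" using A y by (auto simp: outer_def)
  show "(A * outer x y) $$ (i, j) = outer (A *\<^sub>v x) y $$ (i, j)"
    unfolding mult_index[OF A outer_carrier[OF x y] ij]
      outer_index[OF mult_mat_vec_carrier[OF A x] y ij] mult_vec_index[OF A x ij(1)]
    using ij by (simp add: outer_index[OF x y] sum_distrib_right mult.assoc)
qed (use A y in \<open>simp_all add: outer_def\<close>)

lemma adjoint_outer: "mat_adjoint (outer x y) = outer y x"
  by (rule eq_matI) (auto simp: outer_def)

lemma outer_mult:
  assumes A: "A \<in> carrier_mat n m" and x: "x \<in> carrier_vec k" and y: "y \<in> carrier_vec n"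
  shows "outer x y * A = outer x (mat_adjoint A *\<^sub>v y)"
proof -
  have "mat_adjoint (outer x y * A) = mat_adjoint A * outer y x"
    by (simp add: adjoint_mult[OF outer_carrier[OF x y] A] adjoint_outer)
  also have "\<dots> = outer (mat_adjoint A *\<^sub>v y) x"
    by (rule mult_outer[OF adjoint_carrier[OF A] y x])
  finally show ?thesis by (metis adjoint_adjoint adjoint_outer)
qed

lemma trace_outer:
  assumes "x \<in> carrier_vec n" "y \<in> carrier_vec n"
  shows "mat_trace (outer x y) = x \<bullet>c y"
  unfolding cscalar_prod_sum[OF assms(2)] using assms by (simp add: mat_trace_def outer_def)

lemma outer_smult_left:
  assumes "x \<in> carrier_vec n" "y \<in> carrier_vec m"
  shows "outer (c \<cdot>\<^sub>v x) y = c \<cdot>\<^sub>m outer x y" "outer x (c \<cdot>\<^sub>v y) = cnj c \<cdot>\<^sub>m outer x y"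
  using assms by (auto simp: outer_def intro!: eq_matI)

text \<open>The unitary is the reflection along \<open>a - b\<close>, which exchanges a and b.\<close>

lemma exchange_unitary:
  fixes P \<Gamma> \<sigma> :: "complex mat" and a b :: "complex vec" and \<mu> :: real
  assumes P: "P \<in> carrier_mat n n" "mat_adjoint P = P" "P *\<^sub>v a = a" "P *\<^sub>v b = 0\<^sub>v n"
    and \<Gamma>: "\<Gamma> \<in> carrier_mat n n" "mat_adjoint \<Gamma> = \<Gamma>"
      "\<Gamma> *\<^sub>v a = complex_of_real \<mu> \<cdot>\<^sub>v a" "\<Gamma> *\<^sub>v b = complex_of_real \<mu> \<cdot>\<^sub>v b"
    and \<sigma>: "\<sigma> \<in> carrier_mat n n"
    and a: "a \<in> carrier_vec n" "a \<bullet>c a = 1" and b: "b \<in> carrier_vec n" "b \<bullet>c b = 1"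
    and ab: "a \<bullet>c b = 0"
  obtains u where "unitary_mat n u" "u * \<Gamma> = \<Gamma> * u"
    "mat_trace (P * (u * \<sigma> * mat_adjoint u)) = mat_trace (P * \<sigma>) - (\<sigma> *\<^sub>v a) \<bullet>c a + (\<sigma> *\<^sub>v b) \<bullet>c b"
proof -
  define z where "z = a - b"
  have z: "z \<in> carrier_vec n" using a b by (simp add: z_def)
  define Z where "Z = outer z z"
  have Z: "Z \<in> carrier_mat n n" using z by (simp add: Z_def)
  have ba: "b \<bullet>c a = 0"
    using ab by (metis a(1) b(1) carrier_vec_conjugate comm_scalar_prod conjugate_conjugate_sprod conjugate_zero)
  have az: "a \<bullet>c z = 1" and bz: "b \<bullet>c z = -1"
    using a b ab ba by (simp_all add: z_def cscalar_prod_sum[of _ n] sum_subtractf algebra_simps)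
  \<comment> \<open>The vector z has squared norm 2, so the reflection 1 - 2 |z><z| / <z|z> takes
    this form.\<close>
  define u where "u = 1\<^sub>m n - Z"
  have u: "u \<in> carrier_mat n n" using Z unfolding u_def by (rule minus_carrier_mat)
  have u_herm: "mat_adjoint u = u"
  proof (rule eq_matI)
    fix i j assume "i < dim_row u" "j < dim_col u"
    then have "i < n" "j < n" using u by auto
    then show "mat_adjoint u $$ (i, j) = u $$ (i, j)"
      using Z u by (simp add: u_def) (simp add: Z_def outer_index[OF z z])
  qed (use u in auto)
  have uv: "u *\<^sub>v x = x - (x \<bullet>c z) \<cdot>\<^sub>v z" if x: "x \<in> carrier_vec n" for x
  proof (rule eq_vecI)
    fix i assume "i < dim_vec (x - (x \<bullet>c z) \<cdot>\<^sub>v z)"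
    then have i: "i < n" using z by simp
    have "(u *\<^sub>v x) $ i = (\<Sum>k<n. (if i = k then x $ k else 0) - z $ i * (x $ k * cnj (z $ k)))"
      unfolding mult_vec_index[OF u x i]
      using i Z by (intro sum.cong refl) (auto simp: u_def Z_def outer_index[OF z z] algebra_simps)
    also have "\<dots> = x $ i - z $ i * (x \<bullet>c z)"
      using i by (simp add: sum_subtractf cscalar_prod_sum[OF z] sum_distrib_left)
    finally show "(u *\<^sub>v x) $ i = (x - (x \<bullet>c z) \<cdot>\<^sub>v z) $ i" using i x z by simp
  qed (use u z in simp)
  have ua: "u *\<^sub>v a = b" unfolding uv[OF a(1)] az using a b by (auto simp: z_def intro!: eq_vecI)
  have ub: "u *\<^sub>v b = a" unfolding uv[OF b(1)] bz using a b by (auto simp: z_def intro!: eq_vecI)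
  have uA: "u * A = A - outer z (mat_adjoint A *\<^sub>v z)" if "A \<in> carrier_mat n n" for A
    unfolding u_def minus_mult_distrib_mat[OF one_carrier_mat Z that]
    using that by (simp add: Z_def outer_mult[OF that z z])
  have Au: "A * u = A - outer (A *\<^sub>v z) z" if "A \<in> carrier_mat n n" for A
    unfolding u_def mult_minus_distrib_mat[OF that one_carrier_mat Z]
    using that by (simp add: Z_def mult_outer[OF that z z])
  have uz: "u *\<^sub>v z = b - a"
    unfolding z_def by (simp add: mult_minus_distrib_mat_vec[OF u a(1) b(1)] ua ub)
  have "u * u = 1\<^sub>m n"
    unfolding Au[OF u] uz using a b
    by (intro eq_matI) (auto simp: u_def Z_def z_def outer_index[of _ n _ n] algebra_simps outer_def)
  then have unit: "unitary_mat n u" using u by (intro unitary_matI) (simp_all add: u_herm)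
  \<comment> \<open>Here the common eigenvalue of a and b enters: z is then an eigenvector of the
    Hermitian matrix \<Gamma> with a real eigenvalue, so |z><z| commutes with \<Gamma>.\<close>
  have \<Gamma>z: "\<Gamma> *\<^sub>v z = complex_of_real \<mu> \<cdot>\<^sub>v z"
    unfolding z_def mult_minus_distrib_mat_vec[OF \<Gamma>(1) a(1) b(1)] \<Gamma>(3,4) using a b
    by (intro eq_vecI) (auto simp: algebra_simps)
  have comm: "u * \<Gamma> = \<Gamma> * u"
    unfolding uA[OF \<Gamma>(1)] Au[OF \<Gamma>(1)] \<Gamma>(2) \<Gamma>z by (simp add: outer_smult_left[OF z z])
  have Pz: "P *\<^sub>v z = a"
    unfolding z_def using a by (simp add: mult_minus_distrib_mat_vec[OF P(1) a(1) b(1)] P)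
  define B where "B = outer b b" define A where "A = outer a a"
  have A: "A \<in> carrier_mat n n" and B: "B \<in> carrier_mat n n" using a b by (simp_all add: A_def B_def)
  have uP: "u * P \<in> carrier_mat n n" using u P by (simp add: mult_carrier_mat[of _ n n])
  have uPz: "(u * P) *\<^sub>v z = b" using P(1) u z by (simp add: assoc_mult_mat_vec[of _ n n _ n] Pz ua)
  \<comment> \<open>Conjugation replaces the direction a, which P keeps, by the direction b, which P
    annihilates. Cyclicity moves the transformation of \<sigma> onto P, and the change of the trace
    is read off from this formula.\<close>
  have uPu: "u * P * u = P - A + B"
    unfolding Au[OF uP] uPz unfolding uA[OF P(1)] P(2) Pz using a b P(1)
    by (intro eq_matI) (auto simp: A_def B_def z_def outer_def algebra_simps)
  note cm = mult_carrier_mat[of _ n n _ n] and as = assoc_mult_mat[of _ n n _ n _ n]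
  have "mat_trace (P * (u * \<sigma> * mat_adjoint u)) = mat_trace ((P * u * \<sigma>) * u)"
    using P u \<sigma> by (simp add: u_herm as cm)
  also have "\<dots> = mat_trace (u * (P * u * \<sigma>))"
    using P u \<sigma> by (intro trace_comm[of _ n n]) (simp_all add: cm)
  also have "u * (P * u * \<sigma>) = (u * P * u) * \<sigma>" using P u \<sigma> by (simp add: as cm)
  also have "\<dots> = P * \<sigma> - A * \<sigma> + B * \<sigma>"
    unfolding uPu using P A B \<sigma>
    by (simp add: add_mult_distrib_mat[of _ n n] minus_mult_distrib_mat[of _ n n] minus_carrier_mat)
  also have "mat_trace \<dots> = mat_trace (P * \<sigma>) - mat_trace (A * \<sigma>) + mat_trace (B * \<sigma>)"
    using P A B \<sigma> by (simp add: mat_trace_def sum_subtractf sum.distrib)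
  also have "mat_trace (A * \<sigma>) = (\<sigma> *\<^sub>v a) \<bullet>c a"
    unfolding trace_comm[OF A \<sigma>] unfolding A_def mult_outer[OF \<sigma> a(1) a(1)]
    by (rule trace_outer[OF mult_mat_vec_carrier[OF \<sigma> a(1)] a(1)])
  also have "mat_trace (B * \<sigma>) = (\<sigma> *\<^sub>v b) \<bullet>c b"
    unfolding trace_comm[OF B \<sigma>] unfolding B_def mult_outer[OF \<sigma> b(1) b(1)]
    by (rule trace_outer[OF mult_mat_vec_carrier[OF \<sigma> b(1)] b(1)])
  finally show ?thesis by (rule that[OF unit comm])
qed

section \<open>Diagonal states and basis vectors\<close>

lemma diag_is_object:
  fixes g :: "nat \<Rightarrow> real"
  assumes g: "\<And>k. k < n \<Longrightarrow> 0 < g k" and sum: "(\<Sum>k<n. g k) = 1"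
  defines "D \<equiv> mat_diag n (\<lambda>k. complex_of_real (g k))"
  shows "is_object n (D, D)"
proof -
  have D: "D \<in> carrier_mat n n" by (simp add: D_def)
  have herm: "mat_adjoint D = D" by (rule eq_matI) (auto simp: D_def mat_diag_def)
  have D_eq: "D = 1\<^sub>m n * mat_diag n (\<lambda>k. complex_of_real (g k)) * mat_adjoint (1\<^sub>m n)"
    by (simp add: D_def left_mult_one_mat[of _ n n] right_mult_one_mat[of _ n n])
  have one: "unitary_mat n (1\<^sub>m n)" by (simp add: unitary_mat_def)
  have "0 \<le> (D *\<^sub>v x) \<bullet>c x" if x: "x \<in> carrier_vec n" for x
  proof -
    have "0 \<le> (\<Sum>i<n. g i * (cmod ((mat_adjoint (1\<^sub>m n) *\<^sub>v x) $ i))\<^sup>2)"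
      using g by (intro sum_nonneg mult_nonneg_nonneg) (auto intro: less_imp_le)
    then show ?thesis unfolding spectral_form(2)[OF one D_eq x] by (simp add: less_eq_complex_def)
  qed
  moreover have "mat_trace D = complex_of_real (\<Sum>k<n. g k)"
    by (simp add: D_def mat_trace_def mat_diag_def)
  ultimately have dens: "density_matrix n D" using D herm sum by (simp add: density_matrix_def)
  have "D * mat_diag n (\<lambda>k. 1 / complex_of_real (g k)) = mat_diag n (\<lambda>k. complex_of_real (g k) * (1 / complex_of_real (g k)))"
    by (simp add: D_def)
  also have "\<dots> = 1\<^sub>m n"
  proof (rule eq_matI)
    fix i j assume "i < dim_row (1\<^sub>m n :: complex mat)" "j < dim_col (1\<^sub>m n :: complex mat)"
    then show "mat_diag n (\<lambda>k. complex_of_real (g k) * (1 / complex_of_real (g k))) $$ (i, j) = 1\<^sub>m n $$ (i, j)"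
      using g[of j] by (simp add: mat_diag_def)
  qed (simp_all add: mat_diag_def)
  finally have "det D * det (mat_diag n (\<lambda>k. 1 / complex_of_real (g k))) = 1"
    using det_mult[OF D mat_diag_dim, of "\<lambda>k. 1 / complex_of_real (g k)"] by simp
  then have "det D \<noteq> 0" by auto
  then have "full_rank n D" using D vec_space.det_rank_iff[OF D] by (simp add: full_rank_def)
  with dens show ?thesis by (simp add: is_object_def)
qed

lemma diag_mult_unit_vec:
  assumes "k < n"
  shows "mat_diag n f *\<^sub>v unit_vec n k = f k \<cdot>\<^sub>v (unit_vec n k :: complex vec)"
proof (rule eq_vecI)
  fix i assume "i < dim_vec (f k \<cdot>\<^sub>v (unit_vec n k :: complex vec))"
  then have i: "i < n" by simp
  have "(mat_diag n f *\<^sub>v unit_vec n k) $ i = (\<Sum>j<n. if j = k then if i = k then f k else 0 else 0)"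
    unfolding mult_vec_index[OF mat_diag_dim unit_vec_carrier i] using i assms
    by (intro sum.cong refl) (simp add: mat_diag_def)
  then show "(mat_diag n f *\<^sub>v unit_vec n k) $ i = (f k \<cdot>\<^sub>v unit_vec n k) $ i"
    using i assms by simp
qed (simp add: mat_diag_def)

lemma unit_vec_cscalar_prod:
  assumes "i < n" "j < n"
  shows "unit_vec n i \<bullet>c (unit_vec n j :: complex vec) = (if i = j then 1 else 0)"
proof -
  have "(\<Sum>k<n. unit_vec n i $ k * cnj (unit_vec n j $ k)) = (\<Sum>k<n. if k = i then if i = j then 1 else 0 else (0 :: complex))"
    using assms by (intro sum.cong refl) simp
  then show ?thesis unfolding cscalar_prod_sum[OF unit_vec_carrier] using assms by simp
qed

section \<open>Criterion for depleting a level\<close>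

lemma kronecker_diag_mult_unit_vec:
  assumes A: "A \<in> carrier_mat n n" and x: "x \<in> carrier_vec n" and i: "i < m" and j: "j < k"
  shows "kronecker (kronecker A (mat_diag m f)) (mat_diag k h) *\<^sub>v kron_vec (kron_vec x (unit_vec m i)) (unit_vec k j)
    = (f i * h j) \<cdot>\<^sub>v kron_vec (kron_vec (A *\<^sub>v x) (unit_vec m i)) (unit_vec k j)"
proof -
  have Ax: "A *\<^sub>v x \<in> carrier_vec n" by (rule mult_mat_vec_carrier[OF A x])
  have "kronecker (kronecker A (mat_diag m f)) (mat_diag k h) *\<^sub>v kron_vec (kron_vec x (unit_vec m i)) (unit_vec k j)
      = kron_vec (kron_vec (1 \<cdot>\<^sub>v (A *\<^sub>v x)) (f i \<cdot>\<^sub>v unit_vec m i)) (h j \<cdot>\<^sub>v unit_vec k j)"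
    using A x i j
    by (simp add: kronecker_mult_vec[of _ "n * m" "n * m" _ k k] kronecker_mult_vec[of _ n n _ m m]
        diag_mult_unit_vec)
  also have "\<dots> = (f i * h j) \<cdot>\<^sub>v kron_vec (kron_vec (A *\<^sub>v x) (unit_vec m i)) (unit_vec k j)"
    unfolding kron_vec_smult[OF Ax unit_vec_carrier]
      kron_vec_smult[OF kron_vec_carrier[OF Ax unit_vec_carrier] unit_vec_carrier] by simp
  finally show ?thesis .
qed

text \<open>The first column of a diagonalising unitary works. It ensures that the set of deviations
  is nonempty before its supremum is approximated from within.\<close>

lemma exists_unit_eigenvector:
  assumes A: "density_matrix n A" and n: "0 < n"
  obtains x a where "unit_eigenvector A x a"
proof -
  have Ac: "A \<in> carrier_mat n n" using A by (simp add: density_matrix_def)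
  obtain V d where V: "unitary_mat n V"
    and eq: "A = V * mat_diag n (\<lambda>i. complex_of_real (d i)) * mat_adjoint V"
    using density_spectrum[OF A] by metis
  note VC = unitary_matD[OF V]
  define x where "x = V *\<^sub>v unit_vec n 0"
  have x: "x \<in> carrier_vec n" using VC by (simp add: x_def mult_mat_vec_carrier[of _ n n])
  have Vx: "mat_adjoint V *\<^sub>v x = unit_vec n 0"
    unfolding x_def using VC by (subst assoc_mult_mat_vec[of _ n n _ n, symmetric]) auto
  have xx: "x \<bullet>c x = 1"
    using cscalar_prod_adjoint[OF VC(1) unit_vec_carrier x, of 0] n
    by (simp add: x_def[symmetric] Vx unit_vec_cscalar_prod)
  have "vec n (\<lambda>i. complex_of_real (d i) * unit_vec n 0 $ i) = complex_of_real (d 0) \<cdot>\<^sub>v unit_vec n 0"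
    by (intro eq_vecI) auto
  then have "A *\<^sub>v x = complex_of_real (d 0) \<cdot>\<^sub>v x"
    unfolding spectral_form(1)[OF V eq x] Vx by (simp add: mult_mat_vec[OF VC(1) unit_vec_carrier] x_def)
  moreover have "x \<noteq> 0\<^sub>v n" using xx conjugate_square_eq_0_vec[OF x] by auto
  ultimately have "unit_eigenvector A x (d 0)"
    using x xx Ac by (simp add: unit_eigenvector_def eigenvector_def)
  then show ?thesis by (rule that)
qed

text \<open>The auxiliary equilibrium qubit is chosen so that the two product eigenvectors have the
  same total energy, so that exchanging them is an allowed transformation.\<close>

lemma usable_for_depletingI:
  fixes w \<tau> :: "nat \<Rightarrow> real"
  assumes X: "is_object n (\<rho>, \<gamma>)" and pq: "{p, q} = {0, 1}" and \<tau>: "\<And>k. k < 2 \<Longrightarrow> \<tau> k > 0"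
    and x: "unit_eigenvector \<gamma> x a" "a > 0" and y: "unit_eigenvector \<gamma> y b" "b > 0"
    and gain: "a * \<tau> p * (w q * expectation_value \<rho> y) < b * \<tau> q * (w p * expectation_value \<rho> x)"
  shows "usable_for_depleting p (\<rho>, \<gamma>)
    (mat_diag 2 (\<lambda>k. complex_of_real (w k)), mat_diag 2 (\<lambda>k. complex_of_real (\<tau> k)))"
proof -
  let ?w = "mat_diag 2 (\<lambda>k. complex_of_real (w k))" and ?\<tau> = "mat_diag 2 (\<lambda>k. complex_of_real (\<tau> k))"
  have p2: "p < 2" and q2: "q < 2" and npq: "p \<noteq> q" using pq by (auto simp: doubleton_eq_iff)
  have \<rho>c: "\<rho> \<in> carrier_mat n n" and \<gamma>c: "\<gamma> \<in> carrier_mat n n" "mat_adjoint \<gamma> = \<gamma>"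
    using X by (auto simp: is_object_def density_matrix_def)
  have one_less_two: "1 < (2 :: nat)" by simp
  note x' = unit_eigenvectorD[OF x(1) \<gamma>c(1)] and y' = unit_eigenvectorD[OF y(1) \<gamma>c(1)]
  define d where "d = b * \<tau> q + a * \<tau> p"
  have pos: "0 < b * \<tau> q" "0 < a * \<tau> p" using x(2) y(2) \<tau>[OF p2] \<tau>[OF q2] by simp_all
  then have d: "0 < d" by (simp add: d_def)
  define g where "g k = (if k = 0 then b * \<tau> q / d else a * \<tau> p / d)" for k :: nat
  let ?g = "mat_diag 2 (\<lambda>k. complex_of_real (g k))"
  have "(\<Sum>k<2. g k) = 1"
    using d by (simp add: g_def numeral_2_eq_2 add_divide_distrib[symmetric] d_def[symmetric])
  then have Y: "equilibrium_object 2 (?g, ?g)"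
    using diag_is_object[of 2 g] pos d by (simp add: equilibrium_object_def g_def)
  define M where "M = n * 2 * 2"
  define \<sigma> where "\<sigma> = kronecker (kronecker \<rho> ?g) ?w"
  define \<Gamma> where "\<Gamma> = kronecker (kronecker \<gamma> ?g) ?\<tau>"
  have \<sigma>: "\<sigma> \<in> carrier_mat M M" and \<Gamma>: "\<Gamma> \<in> carrier_mat M M"
    unfolding \<sigma>_def \<Gamma>_def M_def by (intro kronecker_carrier \<rho>c \<gamma>c(1) mat_diag_dim)+
  have dh: "mat_adjoint (mat_diag 2 (\<lambda>k. complex_of_real (h k))) = mat_diag 2 (\<lambda>k. complex_of_real (h k))" for h
    by (rule eq_matI) (auto simp: mat_diag_def)
  have \<Gamma>h: "mat_adjoint \<Gamma> = \<Gamma>"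
    unfolding \<Gamma>_def kronecker_adjoint[OF kronecker_carrier[OF \<gamma>c(1) mat_diag_dim] mat_diag_dim]
      kronecker_adjoint[OF \<gamma>c(1) mat_diag_dim] \<gamma>c(2) dh ..
  define P where "P = level_projection (n * 2) 2 p"
  let ?\<delta> = "\<lambda>k. if k = p then 1 else 0 :: complex"
  have P: "P \<in> carrier_mat M M" unfolding P_def M_def by (rule level_projection_carrier)
  \<comment> \<open>The identity on the auxiliary qubit is written as a diagonal matrix, which gives
    P the shape treated in \<open>kronecker_diag_mult_unit_vec\<close>.\<close>
  have P_eq: "P = kronecker (kronecker (1\<^sub>m n) (mat_diag 2 (\<lambda>_. 1))) (mat_diag 2 ?\<delta>)"
    unfolding P_def level_projection_def by (simp add: kronecker_one)
  have Ph: "mat_adjoint P = P"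
    unfolding P_eq kronecker_adjoint[OF kronecker_carrier[OF one_carrier_mat mat_diag_dim] mat_diag_dim]
      kronecker_adjoint[OF one_carrier_mat mat_diag_dim]
    using dh[of "\<lambda>_. 1"] dh[of "\<lambda>k. if k = p then 1 else 0"] by (simp add: if_distrib cong: if_cong)
  define va where "va = kron_vec (kron_vec x (unit_vec 2 0)) (unit_vec 2 p)"
  define vb where "vb = kron_vec (kron_vec y (unit_vec 2 1)) (unit_vec 2 q)"
  have kc: "kron_vec (kron_vec z (unit_vec 2 i)) (unit_vec 2 j) \<in> carrier_vec M"
    if "z \<in> carrier_vec n" for z i j
    unfolding M_def by (intro kron_vec_carrier that unit_vec_carrier)
  have vac: "va \<in> carrier_vec M" and vbc: "vb \<in> carrier_vec M"
    unfolding va_def vb_def by (rule kc[OF x'(1)], rule kc[OF y'(1)])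
  have ip: "kron_vec (kron_vec z (unit_vec 2 i)) (unit_vec 2 j) \<bullet>c kron_vec (kron_vec z' (unit_vec 2 i')) (unit_vec 2 j')
      = (if i = i' \<and> j = j' then z \<bullet>c z' else 0)"
    if "z \<in> carrier_vec n" "z' \<in> carrier_vec n" "i < 2" "i' < 2" "j < 2" "j' < 2" for z z' i i' j j'
    using that by (simp add: kron_vec_cscalar_prod[of _ "n * 2" _ _ 2] kron_vec_cscalar_prod[of _ n _ _ 2]
        unit_vec_cscalar_prod)
  have kv: "kron_vec (kron_vec (c \<cdot>\<^sub>v z) (unit_vec 2 i)) (unit_vec 2 j)
      = c \<cdot>\<^sub>v kron_vec (kron_vec z (unit_vec 2 i)) (unit_vec 2 j)"
    if "z \<in> carrier_vec n" for c z i j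
  proof -
    let ?u = "unit_vec 2 i" and ?v = "unit_vec 2 j"
    have "kron_vec (c \<cdot>\<^sub>v z) (1 \<cdot>\<^sub>v ?u) = (c * 1) \<cdot>\<^sub>v kron_vec z ?u"
      by (rule kron_vec_smult[OF that unit_vec_carrier])
    moreover have "kron_vec (c \<cdot>\<^sub>v kron_vec z ?u) (1 \<cdot>\<^sub>v ?v) = (c * 1) \<cdot>\<^sub>v kron_vec (kron_vec z ?u) ?v"
      by (rule kron_vec_smult[OF kron_vec_carrier[OF that unit_vec_carrier] unit_vec_carrier])
    ultimately show ?thesis by simp
  qed
  have Pa: "P *\<^sub>v va = va"
    unfolding P_eq va_def kronecker_diag_mult_unit_vec[OF one_carrier_mat x'(1) zero_less_numeral p2]
    using x'(1) by simp
  have Pb: "P *\<^sub>v vb = 0\<^sub>v M"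
    unfolding P_eq vb_def kronecker_diag_mult_unit_vec[OF one_carrier_mat y'(1) one_less_two q2]
    using y'(1) npq vbc unfolding vb_def by (auto intro!: eq_vecI)
  \<comment> \<open>The common eigenvalue: \<open>a * g 0 * \<tau> p\<close> and
    \<open>b * g 1 * \<tau> q\<close> both equal it.\<close>
  define \<mu> where "\<mu> = a * b * \<tau> p * \<tau> q / d"
  have \<Gamma>a: "\<Gamma> *\<^sub>v va = complex_of_real \<mu> \<cdot>\<^sub>v va"
    unfolding \<Gamma>_def va_def kronecker_diag_mult_unit_vec[OF \<gamma>c(1) x'(1) zero_less_numeral p2]
      x'(3) kv[OF x'(1)] smult_smult_assoc \<mu>_def
    by (simp add: g_def ac_simps)
  have \<Gamma>b: "\<Gamma> *\<^sub>v vb = complex_of_real \<mu> \<cdot>\<^sub>v vb"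
    unfolding \<Gamma>_def vb_def kronecker_diag_mult_unit_vec[OF \<gamma>c(1) y'(1) one_less_two q2]
      y'(3) kv[OF y'(1)] smult_smult_assoc \<mu>_def
    by (simp add: g_def ac_simps)
  have \<sigma>a: "Re ((\<sigma> *\<^sub>v va) \<bullet>c va) = g 0 * w p * expectation_value \<rho> x"
  proof -
    have "(\<sigma> *\<^sub>v va) \<bullet>c va = complex_of_real (g 0) * complex_of_real (w p) * ((\<rho> *\<^sub>v x) \<bullet>c x)"
      unfolding \<sigma>_def va_def kronecker_diag_mult_unit_vec[OF \<rho>c x'(1) zero_less_numeral p2]
      using cscalar_prod_smult[OF kc[OF mult_mat_vec_carrier[OF \<rho>c x'(1)]] kc[OF x'(1)], of _ 0 p 1 0 p]
      by (simp add: ip[OF mult_mat_vec_carrier[OF \<rho>c x'(1)] x'(1)] p2)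
    then show ?thesis by (simp add: expectation_value_def)
  qed
  have \<sigma>b: "Re ((\<sigma> *\<^sub>v vb) \<bullet>c vb) = g 1 * w q * expectation_value \<rho> y"
  proof -
    have "(\<sigma> *\<^sub>v vb) \<bullet>c vb = complex_of_real (g 1) * complex_of_real (w q) * ((\<rho> *\<^sub>v y) \<bullet>c y)"
      unfolding \<sigma>_def vb_def kronecker_diag_mult_unit_vec[OF \<rho>c y'(1) one_less_two q2]
      using cscalar_prod_smult[OF kc[OF mult_mat_vec_carrier[OF \<rho>c y'(1)]] kc[OF y'(1)], of _ 1 q 1 1 q]
      by (simp add: ip[OF mult_mat_vec_carrier[OF \<rho>c y'(1)] y'(1)] q2)
    then show ?thesis by (simp add: expectation_value_def)
  qed
  \<comment> \<open>Orthogonality of \<open>va\<close> and \<open>vb\<close> comes from the two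
    qubit factors, so x and y may overlap or even coincide.\<close>
  have nrm: "va \<bullet>c va = 1" "vb \<bullet>c vb = 1" "va \<bullet>c vb = 0"
    using x'(1,2) y'(1,2) p2 q2 by (simp_all add: va_def vb_def ip)
  obtain u where u: "unitary_mat M u" "u * \<Gamma> = \<Gamma> * u"
    and tr: "mat_trace (P * (u * \<sigma> * mat_adjoint u))
      = mat_trace (P * \<sigma>) - (\<sigma> *\<^sub>v va) \<bullet>c va + (\<sigma> *\<^sub>v vb) \<bullet>c vb"
    using exchange_unitary[OF P Ph Pa Pb \<Gamma> \<Gamma>h \<Gamma>a \<Gamma>b \<sigma> vac nrm(1) vbc nrm(2,3)] by metis
  have usu: "u * \<sigma> * mat_adjoint u \<in> carrier_mat M M"
    using unitary_matD(1)[OF u(1)] \<sigma> by (simp add: mult_carrier_mat[of _ M M])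
  \<comment> \<open>This is \<open>gain\<close> divided by the normalisation d: less population
    moves into level p than out of it.\<close>
  have "g 1 * w q * expectation_value \<rho> y < g 0 * w p * expectation_value \<rho> x"
    using gain d by (simp add: g_def divide_strict_right_mono ac_simps)
  then have "Re (mat_trace (P * (u * \<sigma> * mat_adjoint u))) < Re (mat_trace (P * \<sigma>))"
    unfolding tr by (simp add: \<sigma>a \<sigma>b)
  then have "Re (reduced_state 2 (u * \<sigma> * mat_adjoint u) $$ (p, p)) < Re (reduced_state 2 \<sigma> $$ (p, p))"
    unfolding P_def reduced_state_trace[OF \<sigma>[unfolded M_def] p2] reduced_state_trace[OF usu[unfolded M_def] p2] .
  moreover have "allowed_unitary ((\<rho>, \<gamma>) \<otimes>\<^sub>o (?g, ?g) \<otimes>\<^sub>o (?w, ?\<tau>)) u"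
    using u carrier_matD(1)[OF \<Gamma>] by (simp add: allowed_unitary_def object_times_def \<Gamma>_def)
  ultimately show ?thesis
    unfolding usable_for_depleting_def using Y
    by (intro exI[of _ 2] exI[of _ "(?g, ?g)"] exI[of _ u]) (simp add: transform_def object_times_def \<sigma>_def)
qed

text \<open>Positivity turns the logarithmic condition into the product inequality of
  \<open>usable_for_depletingI\<close>, which gives one direction. If no pair of eigenvectors
  satisfies it, every ratio attached to level p is at most every ratio attached to level q, and the
  supremum of the former is a separating \<kappa> for
  \<open>not_usable_for_depleting\<close>.\<close>

lemma usable_for_depleting_iff:
  fixes w \<tau> :: "nat \<Rightarrow> real"
  assumes X: "is_object n (\<rho>, \<gamma>)" and fr: "full_rank n \<rho>" and pq: "{p, q} = {0, 1}"
    and \<tau>: "\<And>k. k < 2 \<Longrightarrow> \<tau> k > 0" and w: "\<And>k. k < 2 \<Longrightarrow> w k > 0"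
  shows "usable_for_depleting p (\<rho>, \<gamma>)
      (mat_diag 2 (\<lambda>k. complex_of_real (w k)), mat_diag 2 (\<lambda>k. complex_of_real (\<tau> k)))
    \<longleftrightarrow> (\<exists>x a y b. unit_eigenvector \<gamma> x a \<and> unit_eigenvector \<gamma> y b \<and>
      ln (\<tau> p * w q / (\<tau> q * w p)) < diagonal_deviation (\<rho>, \<gamma>) x a y b)"
    (is "?U \<longleftrightarrow> ?R")
proof -
  have p2: "p < 2" and q2: "q < 2" using pq by (auto simp: doubleton_eq_iff)
  note pos = \<tau>[OF p2] \<tau>[OF q2] w[OF p2] w[OF q2]
  have dens: "density_matrix n \<rho>" "density_matrix n \<gamma>" "full_rank n \<gamma>"
    and \<gamma>c: "\<gamma> \<in> carrier_mat n n"
    using X by (auto simp: is_object_def density_matrix_def)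
  have ev_pos: "0 < a" "0 < expectation_value \<rho> x" if "unit_eigenvector \<gamma> x a" for x a
  proof -
    note x = unit_eigenvectorD[OF that \<gamma>c]
    show "0 < a" using expectation_bounds[OF dens(2,3)] x by (metis order_less_le_trans)
    show "0 < expectation_value \<rho> x"
      using expectation_bounds[OF dens(1) fr] x by (metis order_less_le_trans)
  qed
  have iff: "ln (\<tau> p * w q / (\<tau> q * w p)) < diagonal_deviation (\<rho>, \<gamma>) x a y b \<longleftrightarrow>
      a * \<tau> p * (w q * expectation_value \<rho> y) < b * \<tau> q * (w p * expectation_value \<rho> x)"
    if x: "unit_eigenvector \<gamma> x a" and y: "unit_eigenvector \<gamma> y b" for x a y b
  proof -
    note ps = pos ev_pos[OF x] ev_pos[OF y]
    have "diagonal_deviation (\<rho>, \<gamma>) x a y b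
        = ln (expectation_value \<rho> x * b / (expectation_value \<rho> y * a))"
      using ps by (simp add: diagonal_deviation_def ln_div ln_mult)
    then have "ln (\<tau> p * w q / (\<tau> q * w p)) < diagonal_deviation (\<rho>, \<gamma>) x a y b \<longleftrightarrow>
        \<tau> p * w q / (\<tau> q * w p) < expectation_value \<rho> x * b / (expectation_value \<rho> y * a)"
      using ps by simp
    also have "\<dots> \<longleftrightarrow> a * \<tau> p * (w q * expectation_value \<rho> y) < b * \<tau> q * (w p * expectation_value \<rho> x)"
      using ps by (simp add: divide_less_eq less_divide_eq ac_simps)
    finally show ?thesis .
  qed
  show ?thesis
  proof
    assume ?R
    then obtain x a y b where x: "unit_eigenvector \<gamma> x a" and y: "unit_eigenvector \<gamma> y b"
      and "ln (\<tau> p * w q / (\<tau> q * w p)) < diagonal_deviation (\<rho>, \<gamma>) x a y b" by blast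
    then show ?U
      using usable_for_depletingI[where \<tau> = \<tau> and w = w, OF X pq \<tau> x ev_pos(1)[OF x] y ev_pos(1)[OF y]]
        iff[OF x y] by blast
  next
    assume ?U
    show ?R
    proof (rule ccontr)
      assume "\<not> ?R"
      then have le: "b * \<tau> q * (w p * expectation_value \<rho> x) \<le> a * \<tau> p * (w q * expectation_value \<rho> y)"
        if "unit_eigenvector \<gamma> x a" "unit_eigenvector \<gamma> y b" for x a y b
        using that iff by (meson not_less)
      define f where "f x a = w p * expectation_value \<rho> x / (\<tau> p * a)" for x a
      define F where "F = {f x a | x a. unit_eigenvector \<gamma> x a}"
      have f_le: "f x a \<le> w q * expectation_value \<rho> y / (\<tau> q * b)"
        if "unit_eigenvector \<gamma> x a" "unit_eigenvector \<gamma> y b" for x a y b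
        using le[OF that] pos ev_pos[OF that(1)] ev_pos[OF that(2)]
        by (simp add: f_def divide_le_eq le_divide_eq ac_simps)
      \<comment> \<open>The given x serves twice: its ratio at level q bounds F from above, and its
        ratio at level p shows that F is nonempty, so both supremum rules apply.\<close>
      have "\<kappa> * \<tau> q * a \<le> w q * expectation_value \<rho> x" "w p * expectation_value \<rho> x \<le> \<kappa> * \<tau> p * a"
        if \<kappa>: "\<kappa> = Sup F" and x: "unit_eigenvector \<gamma> x a" for \<kappa> x a
      proof -
        have "f x a \<le> \<kappa>"
          unfolding \<kappa> using x f_le[OF _ x] by (intro cSup_upper bdd_aboveI) (auto simp: F_def)
        then show "w p * expectation_value \<rho> x \<le> \<kappa> * \<tau> p * a"
          using pos ev_pos[OF x] by (simp add: f_def divide_le_eq ac_simps)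
        have "\<kappa> \<le> w q * expectation_value \<rho> x / (\<tau> q * a)"
          unfolding \<kappa> using x f_le[OF _ x] by (intro cSup_least) (auto simp: F_def)
        then show "\<kappa> * \<tau> q * a \<le> w q * expectation_value \<rho> x"
          using pos ev_pos[OF x] by (simp add: le_divide_eq ac_simps)
      qed
      from not_usable_for_depleting[where \<tau> = \<tau> and w = w, OF X pq \<tau> this[OF refl]] show False using \<open>?U\<close> by blast
    qed
  qed
qed

section \<open>Cooling, heating and the range of deviations\<close>

lemma usable_for_cooling_iff: "usable_for_cooling X Q \<longleftrightarrow> usable_for_depleting 1 X Q"
  and usable_for_heating_iff: "usable_for_heating X Q \<longleftrightarrow> usable_for_depleting 0 X Q"
  by (simp_all add: usable_for_cooling_def usable_for_heating_def usable_for_depleting_def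
      upper_occupation_def lower_occupation_def)

text \<open>The eigenvalue of a unit eigenvector is its expectation value in \<gamma>, so the
  uniform bounds for \<rho> and \<gamma> control all four logarithms. Boundedness is what lets the
  real supremum dominate each deviation.\<close>

lemma deviations_bdd_above:
  assumes X: "is_object n (\<rho>, \<gamma>)" and fr: "full_rank n \<rho>"
  shows "bdd_above {\<bar>diagonal_deviation (\<rho>, \<gamma>) x a y b\<bar> | x a y b.
    unit_eigenvector \<gamma> x a \<and> unit_eigenvector \<gamma> y b}"
proof -
  have dens: "density_matrix n \<rho>" "density_matrix n \<gamma>" "full_rank n \<gamma>"
    and \<gamma>c: "\<gamma> \<in> carrier_mat n n"
    using X by (auto simp: is_object_def density_matrix_def)
  obtain lo hi where b1: "0 < lo" "\<And>x. x \<in> carrier_vec n \<Longrightarrow> x \<bullet>c x = 1 \<Longrightarrow>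
      lo \<le> expectation_value \<rho> x \<and> expectation_value \<rho> x \<le> hi"
    using expectation_bounds[OF dens(1) fr] by metis
  obtain lo' hi' where b2: "0 < lo'" "\<And>x. x \<in> carrier_vec n \<Longrightarrow> x \<bullet>c x = 1 \<Longrightarrow>
      lo' \<le> expectation_value \<gamma> x \<and> expectation_value \<gamma> x \<le> hi'"
    using expectation_bounds[OF dens(2,3)] by metis
  have ln_bounds: "ln lo \<le> ln (expectation_value \<rho> x) \<and> ln (expectation_value \<rho> x) \<le> ln hi \<and>
      ln lo' \<le> ln a \<and> ln a \<le> ln hi'" if "unit_eigenvector \<gamma> x a" for x a
  proof -
    note x = unit_eigenvectorD[OF that \<gamma>c]
    show ?thesis using b1(1) b1(2)[OF x(1,2)] b2(1) b2(2)[OF x(1,2)] unfolding x(4)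
      by (auto intro: ln_mono)
  qed
  show ?thesis
  proof (rule bdd_aboveI)
    fix e assume "e \<in> {\<bar>diagonal_deviation (\<rho>, \<gamma>) x a y b\<bar> | x a y b.
      unit_eigenvector \<gamma> x a \<and> unit_eigenvector \<gamma> y b}"
    then obtain x a y b where x: "unit_eigenvector \<gamma> x a" and y: "unit_eigenvector \<gamma> y b"
      and e: "e = \<bar>diagonal_deviation (\<rho>, \<gamma>) x a y b\<bar>" by blast
    show "e \<le> (ln hi - ln lo) + (ln hi' - ln lo')"
      using ln_bounds[OF x] ln_bounds[OF y] unfolding e diagonal_deviation_def fst_conv by linarith
  qed
qed

text \<open>By the eigenvalue equation in components, t \<noteq> v forces one of the two components
  of x to vanish. So x is a basis vector up to a phase, and its expectation values are diagonal
  entries.\<close>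

lemma unit_eigenvector_diag_qubit:
  assumes "t \<noteq> v" "unit_eigenvector (diag_qubit t v) x a"
  shows "a = t \<and> expectation_value (diag_qubit s r) x = s \<or> a = v \<and> expectation_value (diag_qubit s r) x = r"
proof -
  have c: "diag_qubit p q \<in> carrier_mat 2 2" for p q by (simp add: diag_qubit_def)
  note x = unit_eigenvectorD[OF assms(2) c]
  have ix: "(diag_qubit p q *\<^sub>v x) $ 0 = complex_of_real p * x $ 0"
    "(diag_qubit p q *\<^sub>v x) $ 1 = complex_of_real q * x $ 1" for p q
    by (subst mult_vec_index[OF c x(1)], simp, simp add: diag_qubit_def mat_diag_def numeral_2_eq_2)+
  have sp: "z \<bullet>c x = z $ 0 * cnj (x $ 0) + z $ 1 * cnj (x $ 1)" for z
    by (simp add: cscalar_prod_sum[OF x(1)] numeral_2_eq_2)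
  have ev: "expectation_value (diag_qubit s r) x = s * (cmod (x $ 0))\<^sup>2 + r * (cmod (x $ 1))\<^sup>2"
    unfolding expectation_value_def sp ix mult.assoc complex_norm_square[symmetric] by simp
  have "complex_of_real ((cmod (x $ 0))\<^sup>2 + (cmod (x $ 1))\<^sup>2) = complex_of_real 1"
    using x(2) unfolding sp complex_norm_square[symmetric] by simp
  then have nrm: "(cmod (x $ 0))\<^sup>2 + (cmod (x $ 1))\<^sup>2 = 1" by (simp only: of_real_eq_iff)
  have "complex_of_real t * x $ 0 = complex_of_real a * x $ 0"
    "complex_of_real v * x $ 1 = complex_of_real a * x $ 1"
    using ix[of t v] x(1,3) by auto
  then have "x $ 0 = 0 \<or> a = t" "x $ 1 = 0 \<or> a = v" by auto
  then show ?thesis using assms(1) nrm unfolding ev by auto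
qed

lemma unit_eigenvector_unit_vec:
  "unit_eigenvector (diag_qubit t v) (unit_vec 2 0) t" "unit_eigenvector (diag_qubit t v) (unit_vec 2 1) v"
  by (simp_all add: unit_eigenvector_def eigenvector_def diag_qubit_def diag_mult_unit_vec
      unit_vec_cscalar_prod mat_diag_def[of 2, THEN arg_cong[of _ _ dim_row]])

text \<open>Each deviation is 0 or plus or minus this logarithm, and the pair of lower and upper
  basis vector attains it.\<close>

lemma max_diagonal_deviation_qubit:
  assumes "t \<noteq> v" "s > 0" "r > 0" "t > 0" "v > 0"
  shows "max_diagonal_deviation (diag_qubit s r, diag_qubit t v) = \<bar>ln (v * s / (t * r))\<bar>"
  unfolding max_diagonal_deviation_def
proof (rule cSup_eq_maximum)
  have c: "ln (v * s / (t * r)) = ln v + ln s - ln t - ln r"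
    using assms by (simp add: ln_div ln_mult)
  have "expectation_value (diag_qubit s r) (unit_vec 2 0) = s" "expectation_value (diag_qubit s r) (unit_vec 2 1) = r"
    using unit_eigenvector_diag_qubit[OF assms(1) unit_eigenvector_unit_vec(1), of s r]
      unit_eigenvector_diag_qubit[OF assms(1) unit_eigenvector_unit_vec(2), of s r] assms(1) by auto
  then have "\<bar>ln (v * s / (t * r))\<bar>
      = \<bar>diagonal_deviation (diag_qubit s r, diag_qubit t v) (unit_vec 2 0) t (unit_vec 2 1) v\<bar>"
    unfolding c diagonal_deviation_def by simp
  then show "\<bar>ln (v * s / (t * r))\<bar> \<in> {\<bar>diagonal_deviation (diag_qubit s r, diag_qubit t v) x a y b\<bar> | x a y b.
      unit_eigenvector (snd (diag_qubit s r, diag_qubit t v)) x a \<and>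
      unit_eigenvector (snd (diag_qubit s r, diag_qubit t v)) y b}"
    using unit_eigenvector_unit_vec[of t v] by auto
  fix e assume "e \<in> {\<bar>diagonal_deviation (diag_qubit s r, diag_qubit t v) x a y b\<bar> | x a y b.
      unit_eigenvector (snd (diag_qubit s r, diag_qubit t v)) x a \<and>
      unit_eigenvector (snd (diag_qubit s r, diag_qubit t v)) y b}"
  then obtain x a y b where x: "unit_eigenvector (diag_qubit t v) x a" and y: "unit_eigenvector (diag_qubit t v) y b"
    and e: "e = \<bar>diagonal_deviation (diag_qubit s r, diag_qubit t v) x a y b\<bar>" by auto
  show "e \<le> \<bar>ln (v * s / (t * r))\<bar>"
    using unit_eigenvector_diag_qubit[OF assms(1) x, of s r] unit_eigenvector_diag_qubit[OF assms(1) y, of s r]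
    unfolding e c diagonal_deviation_def by auto
qed

section \<open>Comparison of the two thresholds with the maximal deviation\<close>

theorem theorem3:
  fixes \<beta> E s r t v :: real
    and n :: nat
    and \<rho> \<gamma> :: "complex mat"
    and X Q :: thermo_object
  assumes "\<beta> \<noteq> 0"
    and "X = (\<rho>, \<gamma>)"
    and "is_object n X"
    and "full_rank n \<rho>"
    and "Q = (diag_qubit s r, diag_qubit t v)"
    and "E > 0"
    and "s > 0" and "r > 0" and "t > 0" and "v > 0"
    and "s + r = 1" and "t + v = 1"
    and "v / t = exp (- \<beta> * E)"
  shows "(usable_for_cooling X Q \<and> usable_for_heating X Q \<longleftrightarrow>
            max_diagonal_deviation X > max_diagonal_deviation Q) \<and>
         (max_diagonal_deviation X \<le> max_diagonal_deviation Q \<longrightarrow>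
            (usable_for_cooling X Q \<longrightarrow> r > v) \<and>
            (usable_for_heating X Q \<longrightarrow> r < v))"
proof -
  have X: "is_object n (\<rho>, \<gamma>)" using assms by simp
  note pos = assms(7-10)
  \<comment> \<open>A nonzero gap at nonzero \<beta> gives distinct equilibrium populations, the
    nondegeneracy on which the value of D(Q) rests.\<close>
  have tv: "t \<noteq> v"
  proof
    assume "t = v"
    then have "exp (- \<beta> * E) = 1" using assms(13) pos(3) by simp
    then show False using assms(1,6) by simp
  qed
  \<comment> \<open>The threshold for depleting level 1, that is, for cooling; exchanging the levels
    turns it into - c for heating.\<close>
  define c where "c = ln (v * s / (t * r))"
  define f where "f = diagonal_deviation (\<rho>, \<gamma>)"
  define w where "w k = (if k = 0 then s else r)" for k :: nat
  define \<tau> where "\<tau> k = (if k = 0 then t else v)" for k :: nat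
  have Q: "Q = (mat_diag 2 (\<lambda>k. complex_of_real (w k)), mat_diag 2 (\<lambda>k. complex_of_real (\<tau> k)))"
    unfolding assms(5) diag_qubit_def w_def \<tau>_def ..
  have w: "w k > 0" and \<tau>: "\<tau> k > 0" for k using pos by (simp_all add: w_def \<tau>_def)
  have cool: "usable_for_cooling X Q \<longleftrightarrow>
      (\<exists>x a y b. unit_eigenvector \<gamma> x a \<and> unit_eigenvector \<gamma> y b \<and> c < f x a y b)"
    using usable_for_depleting_iff[OF X assms(4), of 1 0 \<tau> w] w \<tau>
    unfolding usable_for_cooling_iff Q assms(2) c_def f_def by (simp add: w_def \<tau>_def insert_commute)
  have heat: "usable_for_heating X Q \<longleftrightarrow>
      (\<exists>x a y b. unit_eigenvector \<gamma> x a \<and> unit_eigenvector \<gamma> y b \<and> - c < f x a y b)"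
  proof -
    have "- c = ln (t * r / (v * s))" using pos by (simp add: c_def ln_div ln_mult)
    then show ?thesis
      using usable_for_depleting_iff[OF X assms(4), of 0 1 \<tau> w] w \<tau>
      unfolding usable_for_heating_iff Q assms(2) f_def by (simp add: w_def \<tau>_def)
  qed
  have swap: "f y b x a = - f x a y b" for x a y b by (simp add: f_def diagonal_deviation_def)
  have DQ: "max_diagonal_deviation Q = \<bar>c\<bar>"
    unfolding assms(5) c_def by (rule max_diagonal_deviation_qubit[OF tv pos])
  have DX: "max_diagonal_deviation X = Sup {\<bar>f x a y b\<bar> | x a y b.
      unit_eigenvector \<gamma> x a \<and> unit_eigenvector \<gamma> y b}" (is "_ = Sup ?F")
    by (simp add: max_diagonal_deviation_def assms(2) f_def)
  have bdd: "bdd_above ?F" unfolding f_def by (rule deviations_bdd_above[OF X assms(4)])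
  have upper: "\<bar>f x a y b\<bar> \<le> max_diagonal_deviation X"
    if "unit_eigenvector \<gamma> x a" "unit_eigenvector \<gamma> y b" for x a y b
    unfolding DX by (rule cSup_upper[OF _ bdd]) (use that in blast)
  have both: "usable_for_cooling X Q \<and> usable_for_heating X Q" if gt: "max_diagonal_deviation X > \<bar>c\<bar>"
  proof -
    have dens: "density_matrix n \<gamma>" using X by (simp add: is_object_def)
    have "dim_row \<gamma> = n" "mat_trace \<gamma> = 1" using dens by (auto simp: density_matrix_def)
    then have n: "0 < n" by (cases n) (auto simp: mat_trace_def)
    obtain x a where "unit_eigenvector \<gamma> x a" by (rule exists_unit_eigenvector[OF dens n])
    then have "?F \<noteq> {}" by blast
    then obtain e where e: "e \<in> ?F" "\<bar>c\<bar> < e" by (rule less_cSupE[OF gt[unfolded DX]])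
    from e(1) obtain x a y b where "unit_eigenvector \<gamma> x a" "unit_eigenvector \<gamma> y b"
      "e = \<bar>f x a y b\<bar>" by blast
    with e(2) have xy: "unit_eigenvector \<gamma> x a" "unit_eigenvector \<gamma> y b" "\<bar>c\<bar> < \<bar>f x a y b\<bar>"
      by simp_all
    \<comment> \<open>One of f and - f equals |f| and therefore exceeds both c and - c; exchanging x
      and y realises the sign.\<close>
    then have "c < f x a y b \<and> - c < f x a y b \<or> c < f y b x a \<and> - c < f y b x a"
      unfolding swap[of y b] by linarith
    then show ?thesis unfolding cool heat using xy(1,2) by blast
  qed
  \<comment> \<open>For 0 \<le> c the cooling threshold is |c| itself, so a deviation above it lifts
    D(X) above |c|. For c < 0 the information comes instead from the sign of c, which says that Q is
    hotter than its equilibrium state.\<close>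
  have cool': "\<bar>c\<bar> < max_diagonal_deviation X" if "usable_for_cooling X Q" "0 \<le> c"
  proof -
    from that(1) obtain x a y b where "unit_eigenvector \<gamma> x a" "unit_eigenvector \<gamma> y b" "c < f x a y b"
      unfolding cool by blast
    with upper[of x a y b] that(2) show ?thesis by simp
  qed
  have heat': "\<bar>c\<bar> < max_diagonal_deviation X" if "usable_for_heating X Q" "c \<le> 0"
  proof -
    from that(1) obtain x a y b where "unit_eigenvector \<gamma> x a" "unit_eigenvector \<gamma> y b" "- c < f x a y b"
      unfolding heat by blast
    with upper[of x a y b] that(2) show ?thesis by simp
  qed
  have sgn: "c < 0 \<Longrightarrow> r > v" "c > 0 \<Longrightarrow> r < v"
  proof -
    have st: "s = 1 - r" "t = 1 - v" using assms(11,12) by simp_all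
    \<comment> \<open>Normalisation cancels the products of r and v, so the sign of c reduces to
      comparing r with v.\<close>
    have "t * r - v * s = r - v" unfolding st by (simp add: algebra_simps)
    then have *: "v * s < t * r \<longleftrightarrow> v < r" "t * r < v * s \<longleftrightarrow> r < v" by linarith+
    have "c < 0 \<longleftrightarrow> v * s < t * r" "0 < c \<longleftrightarrow> t * r < v * s"
      using pos by (simp_all add: c_def)
    then show "c < 0 \<Longrightarrow> r > v" "c > 0 \<Longrightarrow> r < v" using * by simp_all
  qed
  have cool_imp: "\<bar>c\<bar> < max_diagonal_deviation X \<or> c < 0" if "usable_for_cooling X Q"
    using cool'[OF that] by linarith
  have heat_imp: "\<bar>c\<bar> < max_diagonal_deviation X \<or> 0 < c" if "usable_for_heating X Q"
    using heat'[OF that] by linarith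
  show ?thesis
    unfolding DQ not_less[symmetric]
  proof (intro conjI impI iffI)
    assume "usable_for_cooling X Q \<and> usable_for_heating X Q"
    \<comment> \<open>The alternatives c < 0 and 0 < c exclude each other, so cooling and heating
      together leave only the strict inequality.\<close>
    then show "\<bar>c\<bar> < max_diagonal_deviation X" using cool_imp heat_imp by force
  next
    assume "\<bar>c\<bar> < max_diagonal_deviation X"
    then show "usable_for_cooling X Q" "usable_for_heating X Q" using both by auto
  next
    assume "\<not> \<bar>c\<bar> < max_diagonal_deviation X"
    then show "usable_for_cooling X Q \<Longrightarrow> v < r" "usable_for_heating X Q \<Longrightarrow> r < v"
      using cool_imp heat_imp sgn by blast+
  qed
qed

end
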